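(* Assume that there is a constant $C>0$ such that for all $\alpha\in(0,1)$, $$\psi^*(\lambda\theta)\le \frac{C}{\alpha}\,\lambda^{\alpha}\,\psi^*(\theta)\qquad\text{for all }\lambda\ge1,\ \theta>1 .$$ If $f\in\mathcal{C}_0^\beta$ for some $\beta\in(0,1]$, then there exists $t_0>0$ such that for all $t\in(0,t_0)$, $$P_tf=\sum_{k=0}^{\infty}\frac{t^k}{k!}\mathcal{L}^kf\qquad\text{in }\mathcal{C}_0(\mathbb{R}^d).$$
   Context: Let $d\in\mathbb{N}$, $d\geq 1$. Let $\nu$ be a Borel measure on $\mathbb{R}^d$ with $\nu(\{0\})=0$ and $\int_{\mathbb{R}^d}(1\wedge|z|)\,\nu(dz)<\infty$. Put $\psi(\xi)=\int_{\mathbb{R}^d}(1-e^{i\langle\xi,z\rangle})\,\nu(dz)$, $\xi\in\mathbb{R}^d$, and let $(p_t)_{t\ge0}$ be the convolution semigroup of probability measures on $\mathbb{R}^d$ with $\int_{\mathbb{R}^d}e^{i\langle\xi,x\rangle}p_t(dx)=e^{-t\psi(\xi)}$. Define $\psi^*(r)=\sup_{|\xi|\le r}\mathrm{Re}\,\psi(\xi)$ for $r>0$. $\mathcal{C}_0(\mathbb{R}^d)$ is the space of continuous functions $f:\mathbb{R}^d\to\mathbb{R}$ vanishing at infinity, with the supremum norm; convergence of series "in $\mathcal{C}_0(\mathbb{R}^d)$" is in this norm. $P_tf(x)=\int_{\mathbb{R}^d}f(x+y)\,p_t(dy)$ defines a semigroup of operators on $\mathcal{C}_0(\mathbb{R}^d)$;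 $\mathcal{L}$ is its infinitesimal generator, $\mathcal{L}f=\lim_{t\to0^+}(P_tf-f)/t$, with domain $\mathcal{D}(\mathcal{L})$ the set of $f\in\mathcal{C}_0(\mathbb{R}^d)$ for which the limit exists in the supremum norm. $\mathcal{L}^k$ denotes the $k$-fold iterate, $\mathcal{L}^0f=f$. If $\int_{|y|<1}|y|^\beta\nu(dy)<\infty$ then for $f\in\mathcal{C}_0^\beta$ one has $\mathcal{L}f(x)=\int_{\mathbb{R}^d}(f(x+y)-f(x))\,\nu(dy)$. For $\beta\in(0,1]$, the H\"older space $\mathcal{C}_0^\beta$ is the set of $f\in\mathcal{C}_0(\mathbb{R}^d)$ with $\sup_{0<|x-y|\le1}\frac{|f(x)-f(y)|}{|x-y|^\beta}<\infty$. *)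

theory Defs
  imports "HOL-Probability.Probability"
begin

definition char_exponent :: "'a::euclidean_space measure \<Rightarrow> 'a \<Rightarrow> complex" where
  "char_exponent \<nu> \<xi> = (CLINT z|\<nu>. 1 - iexp (\<xi> \<bullet> z))"

definition psi_star :: "'a::euclidean_space measure \<Rightarrow> real \<Rightarrow> real" where
  "psi_star \<nu> r = (SUP \<xi>\<in>{\<xi>. norm \<xi> \<le> r}. Re (char_exponent \<nu> \<xi>))"

text \<open>Families are indexed by all reals, but only times \<open>t \<ge> 0\<close> are constrained.\<close>

definition convolution_semigroup :: "(real \<Rightarrow> 'a::ordered_euclidean_space measure) \<Rightarrow> bool" where
  "convolution_semigroup p \<longleftrightarrow>
     (\<forall>t\<ge>0. prob_space (p t) \<and> sets (p t) = sets borel) \<and>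
     p 0 = return borel 0 \<and>
     (\<forall>s\<ge>0. \<forall>t\<ge>0. p (s + t) = (p s \<star> p t)) \<and>
     (\<forall>f :: 'a \<Rightarrow>\<^sub>C real. ((\<lambda>t. LINT x|p t. f x) \<longlongrightarrow> f 0) (at_right 0))"

text \<open>The norm of the ambient type \<open>'a \<Rightarrow>\<^sub>C real\<close> is the supremum norm.\<close>

definition C0 :: "('a::euclidean_space \<Rightarrow>\<^sub>C real) set" where
  "C0 = {f. (apply_bcontfun f \<longlongrightarrow> 0) at_infinity}"

definition holder_C0 :: "real \<Rightarrow> ('a::euclidean_space \<Rightarrow>\<^sub>C real) set" where
  "holder_C0 \<beta> = {f \<in> C0. bdd_above
     {\<bar>f x - f y\<bar> / norm (x - y) powr \<beta> | x y. 0 < norm (x - y) \<and> norm (x - y) \<le> 1}}"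

definition transition_op :: "'a::euclidean_space measure \<Rightarrow> ('a \<Rightarrow>\<^sub>C real) \<Rightarrow> ('a \<Rightarrow>\<^sub>C real)" where
  "transition_op M f = Bcontfun (\<lambda>x. LINT y|M. f (x + y))"

text \<open>For a Borel probability measure the argument of \<open>Bcontfun\<close> is indeed bounded and
  continuous, and the operator maps \<open>C0\<close> to itself.\<close>

lemma
  fixes M :: "'a::euclidean_space measure" and f :: "'a \<Rightarrow>\<^sub>C real"
  assumes "prob_space M" and M: "sets M = sets borel"
  shows apply_transition_op: "transition_op M f x = (LINT y|M. f (x + y))"
    and transition_op_C0: "f \<in> C0 \<Longrightarrow> transition_op M f \<in> C0"
proof -
  interpret prob_space M by fact
  note [measurable_cong] = M
  have [measurable]: "apply_bcontfun f \<in> borel_measurable borel"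
    by (intro borel_measurable_continuous_onI) simp
  have bound: "\<bar>f z\<bar> \<le> norm f" for z
    using norm_bounded[of f z] by simp
  have "continuous_on UNIV (\<lambda>x. LINT y|M. f (x + y))"
  proof (rule continuous_on_sequentiallyI)
    fix X :: "nat \<Rightarrow> 'a" and x :: 'a
    assume X: "X \<longlonglongrightarrow> x"
    have "(\<lambda>n. f (X n + y)) \<longlonglongrightarrow> f (x + y)" for y
      by (rule continuous_on_tendsto_compose[of UNIV "apply_bcontfun f"])
        (auto intro!: tendsto_intros X)
    then show "(\<lambda>n. LINT y|M. f (X n + y)) \<longlonglongrightarrow> (LINT y|M. f (x + y))"
      by (intro integral_dominated_convergence[where w = "\<lambda>_. norm f"]) (auto intro: bound)
  qed
  moreover have "norm (LINT y|M. f (x + y)) \<le> norm f" for x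
  proof -
    have "norm (LINT y|M. f (x + y)) \<le> (LINT y|M. norm (f (x + y)))"
      by (rule integral_norm_bound)
    also have "\<dots> \<le> norm f"
      by (rule integral_le_const) (auto intro!: integrable_const_bound[where B = "norm f"] bound)
    finally show ?thesis .
  qed
  ultimately have "(\<lambda>x. LINT y|M. f (x + y)) \<in> bcontfun"
    by (auto simp: bcontfun_def bounded_iff)
  then show eq: "transition_op M f x = (LINT y|M. f (x + y))" for x
    by (simp add: transition_op_def Bcontfun_inverse)
  show "transition_op M f \<in> C0" if "f \<in> C0"
  proof -
    have lim: "(apply_bcontfun f \<longlongrightarrow> 0) at_infinity"
      using that by (simp add: C0_def)
    let ?g = "\<lambda>x. LINT y|M. f (x + y)"
    have "(?g \<longlongrightarrow> 0) at_infinity"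
    proof (rule ccontr)
      assume "\<not> (?g \<longlongrightarrow> 0) at_infinity"
      then obtain e where e: "e > 0" and "\<not> (\<exists>b. \<forall>x. b \<le> norm x \<longrightarrow> \<bar>?g x\<bar> < e)"
        unfolding tendsto_iff eventually_at_infinity dist_real_def diff_0_right by blast
      then have "\<forall>n. \<exists>x. real n \<le> norm x \<and> e \<le> \<bar>?g x\<bar>"
        unfolding not_less[symmetric] by blast
      from choice[OF this] obtain X
        where X: "\<And>n. real n \<le> norm (X n)" "\<And>n. e \<le> \<bar>?g (X n)\<bar>"
        by blast
      have "filterlim X at_infinity sequentially"
        by (rule filterlim_norm_at_top_imp_at_infinity)
          (rule filterlim_at_top_mono[OF filterlim_real_sequentially], simp add: X)
      then have "filterlim (\<lambda>n. X n + y) at_infinity sequentially" for y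
        by (rule tendsto_add_filterlim_at_infinity'[OF _ tendsto_const])
      then have "(\<lambda>n. f (X n + y)) \<longlonglongrightarrow> 0" for y
        by (rule filterlim_compose[OF lim])
      then have "(\<lambda>n. ?g (X n)) \<longlonglongrightarrow> (LINT y|M. 0)"
        by (intro integral_dominated_convergence[where w = "\<lambda>_. norm f"]) (auto intro: bound)
      then have "(\<lambda>n. \<bar>?g (X n)\<bar>) \<longlonglongrightarrow> 0"
        by (intro tendsto_rabs_zero) simp
      then have "e \<le> 0"
        by (rule LIMSEQ_le_const) (use X in auto)
      with e show False by simp
    qed
    moreover have "apply_bcontfun (transition_op M f) = ?g"
      by (simp add: fun_eq_iff eq)
    ultimately show ?thesis
      by (simp add: C0_def)
  qed
qed

text \<open>The infinitesimal generator of a family \<open>T\<close> of operators on \<open>C0\<close>; its value is meaningful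
  only on the domain.\<close>

definition generator_domain ::
    "(real \<Rightarrow> ('a::euclidean_space \<Rightarrow>\<^sub>C real) \<Rightarrow> ('a \<Rightarrow>\<^sub>C real)) \<Rightarrow> ('a \<Rightarrow>\<^sub>C real) set" where
  "generator_domain T = {f \<in> C0. \<exists>g \<in> C0. ((\<lambda>t. (T t f - f) /\<^sub>R t) \<longlongrightarrow> g) (at_right 0)}"

definition generator ::
    "(real \<Rightarrow> ('a::euclidean_space \<Rightarrow>\<^sub>C real) \<Rightarrow> ('a \<Rightarrow>\<^sub>C real)) \<Rightarrow> ('a \<Rightarrow>\<^sub>C real) \<Rightarrow> ('a \<Rightarrow>\<^sub>C real)" where
  "generator T f = Lim (at_right 0) (\<lambda>t. (T t f - f) /\<^sub>R t)"

end

theory Submission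
  imports Defs
begin

text \<open>Put $m(z) = \min(1, |z|)$ and $A g(x) = \int (g(x+y) - g(x))\,\nu(dy)$.

  \<^bold>\<open>Size of the iterates.\<close> The growth condition says that there are few small jumps: averaging
  $1 - \cos$ over frequencies bounds $\nu(|z| \ge r)$ by a multiple of $\psi^*(c/r)$, hence by
  $(D/\alpha)\, r^{-\alpha}$ for every $\alpha \in (0,1)$. With $\alpha = \beta/2$ this yields
  $\int m^\beta\, d\nu \le M/\beta$ for all $\beta \in (0,1]$ with one constant $M$
  (\<open>jump_measure_logarithmic_exponent\<close>). Consequently $A$ may lose as little Hoelder regularity
  $\epsilon$ as desired, at the price of a factor $2M/\epsilon$ (\<open>jump_op_hoelder\<close>). Spending half of
  the exponent of $f$ in $n$ equal portions gives $\|A^n f\| \le K (4Mn/\beta)^n$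
  (\<open>norm_iterate_le\<close>), and $n^n/n! \le e^n$ makes $\frac{t^n}{n!}\|A^n f\|$ decay geometrically as
  soon as $4eMt < \beta$.

  \<^bold>\<open>The operator A generates the semigroup.\<close> Everything else rests on
  $P_t g - g = \int_0^t P_s A g\, ds$ for Hoelder functions $g$ (\<open>dynkin_formula\<close>). With the strong
  continuity of the semigroup it shows that $A$ agrees with the generator on Hoelder functions
  vanishing at infinity, and its iteration gives Taylor's formula with remainder at most
  $\frac{t^n}{n!}\|A^n f\|$ (\<open>taylor_remainder\<close>).

  For characters the formula is just the derivative of $e^{-t\psi(\xi)}$. To pass to $g$ one needs
  trigonometric polynomials $u$ for which $u$ and $A u$ approximate $g$ and $A g$ simultaneously.
  A function $F$ which is a uniform limit of trigonometric polynomials is treated through the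
  resolvent: $A$ multiplies the character of frequency $\xi$ by $-\psi(\xi)$ and
  $1 + \psi(\xi) \neq 0$, so $u - A u = h$ is solvable for trigonometric polynomials $h$. If $h$ is
  close to $F - A F$, which is a uniform limit of trigonometric polynomials as well, then the maximum principle $\|v\| \le \|v - A v\|$ for $v = u - F$ shows that
  $u$ is close to $F$, and therefore $A u$ to $A F$. Finally $g$ is a bounded pointwise limit of such
  $F$, namely of $g(R \sin(x_1/R), \ldots, R \sin(x_d/R))$ as $R \to \infty$: these are functions of
  sines on a cube, so the Stone-Weierstrass theorem applies, and they satisfy the same Hoelder bound
  as $g$ since $R \sin(\cdot/R)$ is a contraction (\<open>trig_poly_approximation\<close>).\<close>

section \<open>Hoelder functions\<close>

definition cut_norm :: "'a::real_normed_vector \<Rightarrow> real" where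
  "cut_norm z = min 1 (norm z)"

text \<open>Using \<^const>\<open>cut_norm\<close> instead of the norm makes $K$ bound the oscillation of $g$ as well as
  its Hoelder seminorm, so that no supremum norm has to be carried along.\<close>

definition hoelder :: "real \<Rightarrow> real \<Rightarrow> ('a::euclidean_space \<Rightarrow> real) \<Rightarrow> bool" where
  "hoelder \<beta> K g \<longleftrightarrow> (\<forall>x y. \<bar>g x - g y\<bar> \<le> K * cut_norm (x - y) powr \<beta>)"

lemma cut_norm_bounds [simp]: "0 \<le> cut_norm z" "cut_norm z \<le> 1" "cut_norm z \<le> norm z"
  by (auto simp: cut_norm_def)

lemma cut_norm_zero [simp]: "cut_norm 0 = 0"
  by (simp add: cut_norm_def)

lemma continuous_on_cut_norm [continuous_intros]:
  "continuous_on S f \<Longrightarrow> continuous_on S (\<lambda>x. cut_norm (f x))"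
  unfolding cut_norm_def by (intro continuous_intros)

lemma measurable_cut_norm [measurable]: "cut_norm \<in> borel_measurable borel"
  unfolding cut_norm_def by measurable

lemma cut_norm_powr_bounds [simp]: "0 \<le> cut_norm z powr \<beta>" "0 \<le> \<beta> \<Longrightarrow> cut_norm z powr \<beta> \<le> 1"
  by (auto intro!: powr_le1)

lemma cut_norm_powr_antimono: "\<alpha> \<le> \<beta> \<Longrightarrow> cut_norm z powr \<beta> \<le> cut_norm z powr \<alpha>"
  by (rule powr_mono') auto

lemma hoelderD: "hoelder \<beta> K g \<Longrightarrow> \<bar>g x - g y\<bar> \<le> K * cut_norm (x - y) powr \<beta>"
  by (simp add: hoelder_def)

lemma hoelder_shift: "hoelder \<beta> K g \<Longrightarrow> \<bar>g (x + y) - g x\<bar> \<le> K * cut_norm y powr \<beta>"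
  using hoelderD[of \<beta> K g "x + y" x] by simp

lemma hoelder_nonneg: "hoelder \<beta> K g \<Longrightarrow> 0 \<le> K"
  for g :: "'a::euclidean_space \<Rightarrow> real"
  using hoelderD[of \<beta> K g "SOME b. b \<in> Basis" 0]
  by (simp add: cut_norm_def norm_some_Basis)

lemma hoelder_osc:
  assumes "hoelder \<beta> K g" "0 \<le> \<beta>"
  shows "\<bar>g x - g y\<bar> \<le> K"
  using hoelderD[OF assms(1), of x y]
    mult_left_le[OF cut_norm_powr_bounds(2)[OF assms(2)] hoelder_nonneg[OF assms(1)]]
  by (meson order_trans)

lemma hoelder_bounded:
  assumes "hoelder \<beta> K g" "0 \<le> \<beta>"
  shows "\<bar>g x\<bar> \<le> \<bar>g 0\<bar> + K"
  using hoelder_osc[OF assms, of x 0] by linarith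

lemma hoelder_weaken:
  assumes "hoelder \<beta> K g" "\<alpha> \<le> \<beta>" "K \<le> K'"
  shows "hoelder \<alpha> K' g"
  unfolding hoelder_def
proof (intro allI)
  fix x y
  have "\<bar>g x - g y\<bar> \<le> K * cut_norm (x - y) powr \<beta>" by (rule hoelderD[OF assms(1)])
  also have "\<dots> \<le> K' * cut_norm (x - y) powr \<alpha>"
    using assms hoelder_nonneg[OF assms(1)] by (intro mult_mono cut_norm_powr_antimono) auto
  finally show "\<bar>g x - g y\<bar> \<le> K' * cut_norm (x - y) powr \<alpha>" .
qed

lemma hoelder_add:
  assumes "hoelder \<beta> K g" "hoelder \<beta> K' h"
  shows "hoelder \<beta> (K + K') (\<lambda>x. g x + h x)"
  unfolding hoelder_def
  using hoelderD[OF assms(1)] hoelderD[OF assms(2)]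
  by (smt (verit, best) distrib_right)

lemma hoelder_uminus: "hoelder \<beta> K g \<Longrightarrow> hoelder \<beta> K (\<lambda>x. - g x)"
  unfolding hoelder_def by (smt (verit))

lemma hoelder_diff:
  assumes "hoelder \<beta> K g" "hoelder \<beta> K' h"
  shows "hoelder \<beta> (K + K') (\<lambda>x. g x - h x)"
  using hoelder_add[OF assms(1) hoelder_uminus[OF assms(2)]] by simp

lemma hoelder_continuous:
  fixes g :: "'a::euclidean_space \<Rightarrow> real"
  assumes "hoelder \<beta> K g" "0 < \<beta>"
  shows "continuous_on UNIV g"
proof (rule continuous_at_imp_continuous_on, intro ballI)
  fix x :: 'a
  have "((\<lambda>y. K * cut_norm (y - x) powr \<beta>) \<longlongrightarrow> K * 0) (at x)"
  proof (intro tendsto_mult tendsto_const)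
    have "continuous_on UNIV (\<lambda>y. cut_norm (y - x) powr \<beta>)"
      using assms(2) by (intro continuous_intros continuous_on_powr') auto
    then have "((\<lambda>y. cut_norm (y - x) powr \<beta>) \<longlongrightarrow> cut_norm (x - x) powr \<beta>) (at x)"
      unfolding continuous_on_def by blast
    then show "((\<lambda>y. cut_norm (y - x) powr \<beta>) \<longlongrightarrow> 0) (at x)" by simp
  qed
  then have lim: "((\<lambda>y. K * cut_norm (y - x) powr \<beta>) \<longlongrightarrow> 0) (at x)"
    by simp
  have "((\<lambda>y. g y - g x) \<longlongrightarrow> 0) (at x)"
    by (rule Lim_null_comparison[OF _ lim]) (simp add: hoelderD[OF assms(1)])
  then show "isCont g x"
    by (simp add: isCont_def LIM_zero_iff)
qed

lemma hoelder_measurable: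
  assumes "hoelder \<beta> K g" "0 < \<beta>"
  shows "g \<in> borel_measurable borel"
  using hoelder_continuous[OF assms] by (rule borel_measurable_continuous_onI)

text \<open>Composition with a contraction preserves the constant; this is what keeps the approximants
  $g(R \sin(x_1/R), \ldots)$ uniformly Hoelder.\<close>

lemma hoelder_compose_contraction:
  assumes "hoelder \<beta> K g" "0 \<le> \<beta>" "\<And>x y. norm (T x - T y) \<le> norm (x - y)"
  shows "hoelder \<beta> K (\<lambda>x. g (T x))"
  unfolding hoelder_def
proof (intro allI)
  fix x y
  have "\<bar>g (T x) - g (T y)\<bar> \<le> K * cut_norm (T x - T y) powr \<beta>" by (rule hoelderD[OF assms(1)])
  also have "\<dots> \<le> K * cut_norm (x - y) powr \<beta>"
    using hoelder_nonneg[OF assms(1)] assms(2) assms(3)[of x y]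
    by (intro mult_left_mono powr_mono2) (auto simp: cut_norm_def)
  finally show "\<bar>g (T x) - g (T y)\<bar> \<le> K * cut_norm (x - y) powr \<beta>" .
qed

text \<open>At distances above $1$ the increment is bounded by twice the supremum norm, which is absorbed into
  the constant.\<close>

lemma holder_C0_hoelder:
  assumes f: "f \<in> holder_C0 \<beta>" and \<beta>: "0 < \<beta>"
  shows "\<exists>K. hoelder \<beta> K (apply_bcontfun f)"
proof -
  obtain B where B: "\<And>x y. 0 < norm (x - y) \<Longrightarrow> norm (x - y) \<le> 1 \<Longrightarrow> \<bar>f x - f y\<bar> / norm (x - y) powr \<beta> \<le> B"
    using f unfolding holder_C0_def bdd_above_def by blast
  have "\<bar>f x - f y\<bar> \<le> max B (2 * norm f) * cut_norm (x - y) powr \<beta>" for x y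
  proof -
    consider "x = y" | "0 < norm (x - y)" "norm (x - y) \<le> 1" | "1 < norm (x - y)"
      using zero_less_norm_iff[of "x - y"] by (cases "x = y"; cases "norm (x - y) \<le> 1") auto
    then show ?thesis
    proof cases
      case 2
      then have "\<bar>f x - f y\<bar> \<le> B * norm (x - y) powr \<beta>"
        using B[of x y] by (simp add: divide_le_eq)
      also have "\<dots> \<le> max B (2 * norm f) * norm (x - y) powr \<beta>"
        by (intro mult_right_mono) auto
      finally show ?thesis using 2 by (simp add: cut_norm_def)
    next
      case 3
      have "\<bar>f x - f y\<bar> \<le> 2 * norm f"
        using norm_bounded[of f x] norm_bounded[of f y] by simp
      with 3 show ?thesis by (simp add: cut_norm_def)
    qed simp
  qed
  then show ?thesis unfolding hoelder_def by blast
qed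

section \<open>Trigonometric polynomials\<close>

text \<open>The real span of all $\cos\langle\xi,x\rangle$ and $\sin\langle\xi,x\rangle$. A complex amplitude
  treats both at once and turns operators that are diagonal on characters into multiplications.\<close>

inductive trig_poly :: "('a::euclidean_space \<Rightarrow> real) \<Rightarrow> bool" where
  trig_poly_char: "trig_poly (\<lambda>x. Re (c * iexp (\<xi> \<bullet> x)))"
| trig_poly_add: "trig_poly f \<Longrightarrow> trig_poly g \<Longrightarrow> trig_poly (\<lambda>x. f x + g x)"

lemma trig_poly_const: "trig_poly (\<lambda>x. a)"
  using trig_poly_char[of "complex_of_real a" 0] by simp

lemma trig_poly_cmult: "trig_poly f \<Longrightarrow> trig_poly (\<lambda>x. a * f x)"
proof (induction rule: trig_poly.induct)
  case (trig_poly_char c \<xi>)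
  show ?case
    using trig_poly.trig_poly_char[of "complex_of_real a * c" \<xi>] by (simp add: algebra_simps)
next
  case (trig_poly_add f g)
  then show ?case using trig_poly.trig_poly_add[of "\<lambda>x. a * f x" "\<lambda>x. a * g x"]
    by (simp add: distrib_left)
qed

lemma trig_poly_sum:
  assumes "finite I" "\<And>i. i \<in> I \<Longrightarrow> trig_poly (f i)"
  shows "trig_poly (\<lambda>x. \<Sum>i\<in>I. f i x)"
  using assms by (induction rule: finite_induct) (auto intro: trig_poly_const trig_poly_add)

lemma trig_poly_sin: "trig_poly (\<lambda>x. sin (\<xi> \<bullet> x))"
  using trig_poly_char[of "-\<i>" \<xi>] by (simp add: exp_Euler cos_of_real sin_of_real)

text \<open>From $2\,\mathrm{Re}\,a\,\mathrm{Re}\,b = \mathrm{Re}\,(ab) + \mathrm{Re}\,(a\bar b)$.\<close>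

lemma trig_poly_char_mult:
  "trig_poly (\<lambda>x. Re (c * iexp (\<xi> \<bullet> x)) * Re (d * iexp (\<eta> \<bullet> x)))"
proof -
  have eq: "Re (c * iexp (\<xi> \<bullet> x)) * Re (d * iexp (\<eta> \<bullet> x)) =
      Re (c * d / 2 * iexp ((\<xi> + \<eta>) \<bullet> x)) + Re (c * cnj d / 2 * iexp ((\<xi> - \<eta>) \<bullet> x))" for x
  proof -
    have re: "Re a * Re b = Re (a * b / 2) + Re (a * cnj b / 2)" for a b
      by (simp add: field_simps)
    have "iexp ((\<xi> + \<eta>) \<bullet> x) = iexp (\<xi> \<bullet> x) * iexp (\<eta> \<bullet> x)"
      by (simp add: inner_add_left ring_distribs exp_add)
    moreover have "iexp ((\<xi> - \<eta>) \<bullet> x) = iexp (\<xi> \<bullet> x) * cnj (iexp (\<eta> \<bullet> x))"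
      by (simp add: inner_diff_left ring_distribs exp_add[symmetric] exp_cnj)
    ultimately show ?thesis
      by (subst re) (simp add: mult_ac)
  qed
  show ?thesis
    unfolding eq by (intro trig_poly_add trig_poly_char)
qed

lemma trig_poly_mult:
  assumes "trig_poly f" "trig_poly g"
  shows "trig_poly (\<lambda>x. f x * g x)"
  using assms(1)
proof (induction rule: trig_poly.induct)
  case (trig_poly_char c \<xi>)
  from assms(2) show ?case
  proof (induction rule: trig_poly.induct)
    case (trig_poly_char d \<eta>)
    show ?case by (rule trig_poly_char_mult)
  qed (auto simp: distrib_left intro: trig_poly_add)
qed (auto simp: distrib_right intro: trig_poly_add)

lemma norm_iexp_diff_le: "cmod (iexp s - iexp t) \<le> min 2 \<bar>s - t\<bar>"
proof -
  have "iexp s - iexp t = iexp t * (iexp (s - t) - 1)"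
    by (simp add: right_diff_distrib exp_diff)
  then have eq: "cmod (iexp s - iexp t) = cmod (iexp (s - t) - 1)"
    by (simp add: norm_mult)
  have "cmod (iexp s - iexp t) \<le> 2"
    using norm_triangle_ineq4[of "iexp s" "iexp t"] by simp
  moreover have "cmod (iexp (s - t) - 1) \<le> \<bar>s - t\<bar>"
    using iexp_approx1[of "s - t" 0] by simp
  ultimately show ?thesis using eq by simp
qed

lemma norm_char_diff_le:
  "cmod (iexp (\<xi> \<bullet> x) - iexp (\<xi> \<bullet> y)) \<le> (2 + norm \<xi>) * cut_norm (x - y)"
proof -
  have "\<bar>\<xi> \<bullet> x - \<xi> \<bullet> y\<bar> \<le> norm \<xi> * norm (x - y)"
    using Cauchy_Schwarz_ineq2[of \<xi> "x - y"] by (simp add: inner_diff_right)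
  then have "cmod (iexp (\<xi> \<bullet> x) - iexp (\<xi> \<bullet> y)) \<le> min 2 (norm \<xi> * norm (x - y))"
    using norm_iexp_diff_le[of "\<xi> \<bullet> x" "\<xi> \<bullet> y"] by simp
  also have "\<dots> \<le> (2 + norm \<xi>) * cut_norm (x - y)"
  proof (cases "norm (x - y) \<le> 1")
    case True
    then have "norm \<xi> * norm (x - y) \<le> (2 + norm \<xi>) * norm (x - y)"
      by (intro mult_right_mono) auto
    with True show ?thesis by (auto simp: cut_norm_def)
  qed (simp add: cut_norm_def min.coboundedI1)
  finally show ?thesis .
qed

lemma trig_poly_hoelder: "trig_poly u \<Longrightarrow> \<exists>K. hoelder 1 K u"
proof (induction rule: trig_poly.induct)
  case (trig_poly_char c \<xi>)
  have "\<bar>Re (c * iexp (\<xi> \<bullet> x)) - Re (c * iexp (\<xi> \<bullet> y))\<bar>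
      \<le> cmod c * (2 + norm \<xi>) * cut_norm (x - y) powr 1" for x y
  proof -
    have "\<bar>Re (c * iexp (\<xi> \<bullet> x)) - Re (c * iexp (\<xi> \<bullet> y))\<bar>
        = \<bar>Re (c * (iexp (\<xi> \<bullet> x) - iexp (\<xi> \<bullet> y)))\<bar>"
      by (simp add: algebra_simps)
    also have "\<dots> \<le> cmod c * cmod (iexp (\<xi> \<bullet> x) - iexp (\<xi> \<bullet> y))"
      using abs_Re_le_cmod norm_mult by metis
    also have "\<dots> \<le> cmod c * ((2 + norm \<xi>) * cut_norm (x - y))"
      by (intro mult_left_mono norm_char_diff_le) auto
    finally show ?thesis by (simp add: mult.assoc)
  qed
  then show ?case unfolding hoelder_def by blast
next
  case (trig_poly_add f g)
  then show ?case using hoelder_add by blast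
qed

text \<open>The vector of scaled sines ranges over a cube, on which $G$ is uniformly approximated by polynomials;
  a polynomial in sines is a trigonometric polynomial.\<close>

lemma trig_poly_dense_sin:
  fixes G :: "'a::euclidean_space \<Rightarrow> real"
  assumes "continuous_on UNIV G" "0 < e"
  obtains q where "trig_poly q"
    "\<And>x. \<bar>G (\<Sum>b\<in>Basis. (R * sin ((b /\<^sub>R R) \<bullet> x)) *\<^sub>R b) - q x\<bar> < e"
proof -
  define S :: "'a \<Rightarrow> 'a" where "S x = (\<Sum>b\<in>Basis. (R * sin ((b /\<^sub>R R) \<bullet> x)) *\<^sub>R b)" for x
  let ?B = "cbox (\<Sum>b\<in>Basis. (- \<bar>R\<bar>) *\<^sub>R b) (\<Sum>b\<in>Basis. \<bar>R\<bar> *\<^sub>R b) :: 'a set"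
  have box: "S x \<in> ?B" for x
  proof -
    have "\<bar>R * sin t\<bar> \<le> \<bar>R\<bar>" for t
      by (simp add: abs_mult mult_left_le)
    then have "- \<bar>R\<bar> \<le> R * sin t" "R * sin t \<le> \<bar>R\<bar>" for t
      by (auto simp: abs_le_iff minus_le_iff)
    then show ?thesis
      by (auto simp: mem_box S_def simp del: scaleR_minus_left)
  qed
  obtain r where r: "real_polynomial_function r" "\<And>v. v \<in> ?B \<Longrightarrow> \<bar>G v - r v\<bar> < e"
    using Stone_Weierstrass_real_polynomial_function[of ?B G e] assms
      continuous_on_subset[OF assms(1)] by auto
  have "trig_poly (\<lambda>x. r (S x))"
    using r(1)
  proof (induction rule: real_polynomial_function.induct)
    case (linear f)
    then interpret bounded_linear f .
    show ?case
      unfolding S_def sum scaleR real_scaleR_def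
      by (intro trig_poly_sum finite_Basis trig_poly_mult trig_poly_const trig_poly_sin)
  qed (auto intro: trig_poly_const trig_poly_add trig_poly_mult)
  then show ?thesis
    using that[of "\<lambda>x. r (S x)"] r(2)[OF box] by (simp add: S_def)
qed

lemma norm_sin_scaling_le:
  fixes x y :: "'a::euclidean_space"
  assumes "0 < R"
  shows "norm ((\<Sum>b\<in>Basis. (R * sin ((b /\<^sub>R R) \<bullet> x)) *\<^sub>R b) -
    (\<Sum>b\<in>Basis. (R * sin ((b /\<^sub>R R) \<bullet> y)) *\<^sub>R b)) \<le> norm (x - y)"
proof (rule norm_le_componentwise)
  fix b :: 'a assume b: "b \<in> Basis"
  have "\<bar>R * sin s - R * sin t\<bar> \<le> \<bar>R * (s - t)\<bar>" for s t
  proof -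
    have "\<bar>sin s - sin t\<bar> = 2 * \<bar>sin ((s - t) / 2)\<bar> * \<bar>cos ((s + t) / 2)\<bar>"
      by (simp add: sin_diff_sin abs_mult)
    also have "\<dots> \<le> 2 * \<bar>(s - t) / 2\<bar> * 1"
      by (intro mult_mono abs_sin_x_le_abs_x abs_cos_le_one mult_left_mono) auto
    finally show ?thesis
      using assms by (simp add: abs_mult mult_left_mono flip: right_diff_distrib)
  qed
  from this[of "(b /\<^sub>R R) \<bullet> x" "(b /\<^sub>R R) \<bullet> y"]
  show "\<bar>((\<Sum>b\<in>Basis. (R * sin ((b /\<^sub>R R) \<bullet> x)) *\<^sub>R b) -
    (\<Sum>b\<in>Basis. (R * sin ((b /\<^sub>R R) \<bullet> y)) *\<^sub>R b)) \<bullet> b\<bar> \<le> \<bar>(x - y) \<bullet> b\<bar>"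
    using assms b mult.assoc[of R "inverse R", symmetric]
    by (simp add: inner_diff_left[of "sum _ _"] inner_diff_left[of x] inner_commute[of b]
      flip: right_diff_distrib)
qed

lemma sin_scaling_tendsto:
  fixes x :: "'a::euclidean_space"
  shows "(\<lambda>n. \<Sum>b\<in>Basis. (real (Suc n) * sin ((b /\<^sub>R real (Suc n)) \<bullet> x)) *\<^sub>R b) \<longlonglongrightarrow> x"
proof -
  have "(\<lambda>n. real (Suc n) * sin (a / real (Suc n))) \<longlonglongrightarrow> a" for a :: real
    by real_asymp
  then have "(\<lambda>n. \<Sum>b\<in>Basis. (real (Suc n) * sin ((b \<bullet> x) / real (Suc n))) *\<^sub>R b)
      \<longlonglongrightarrow> (\<Sum>b\<in>Basis. (b \<bullet> x) *\<^sub>R b)"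
    by (intro tendsto_sum tendsto_scaleR tendsto_const)
  then show ?thesis
    by (simp add: euclidean_representation inner_commute[of _ x] divide_inverse mult.commute)
qed

section \<open>The jump operator on Hoelder functions\<close>

text \<open>The generator on Hoelder functions, as will turn out. It is defined on plain functions since the
  approximants below do not vanish at infinity.\<close>

definition jump_op :: "'a::euclidean_space measure \<Rightarrow> ('a \<Rightarrow> real) \<Rightarrow> 'a \<Rightarrow> real" where
  "jump_op \<nu> g x = (LINT y|\<nu>. g (x + y) - g x)"

text \<open>Integrability of every positive power of \<^const>\<open>cut_norm\<close> is what the growth condition provides;
  it makes the jump operator meaningful for every Hoelder exponent.\<close>

locale jump_measure =
  fixes \<nu> :: "'a::euclidean_space measure"
  assumes sets_eq_borel [measurable_cong]: "sets \<nu> = sets borel"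
    and integrable_cut_norm_powr: "0 < \<beta> \<Longrightarrow> \<beta> \<le> 1 \<Longrightarrow> integrable \<nu> (\<lambda>z. cut_norm z powr \<beta>)"
begin

definition moment :: "real \<Rightarrow> real" where
  "moment \<beta> = (LINT z|\<nu>. cut_norm z powr \<beta>)"

lemma integrable_cut_norm: "integrable \<nu> cut_norm"
  using integrable_cut_norm_powr[of 1] by simp

lemma integrable_jump:
  assumes "hoelder \<beta> K g" "0 < \<beta>" "\<beta> \<le> 1"
  shows "integrable \<nu> (\<lambda>y. g (x + y) - g x)"
proof (rule Bochner_Integration.integrable_bound)
  have [measurable]: "g \<in> borel_measurable borel"
    using assms by (intro hoelder_measurable)
  show "integrable \<nu> (\<lambda>y. K * cut_norm y powr \<beta>)"
    using integrable_cut_norm_powr[of \<beta>] assms by simp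
  show "(\<lambda>y. g (x + y) - g x) \<in> borel_measurable \<nu>" by measurable
  show "AE y in \<nu>. norm (g (x + y) - g x) \<le> norm (K * cut_norm y powr \<beta>)"
    using hoelder_shift[OF assms(1), of x] hoelder_nonneg[OF assms(1)] by (simp add: abs_mult)
qed

lemma jump_op_add:
  assumes "hoelder \<beta> K g" "hoelder \<beta> K' h" "0 < \<beta>" "\<beta> \<le> 1"
  shows "jump_op \<nu> (\<lambda>x. g x + h x) = (\<lambda>x. jump_op \<nu> g x + jump_op \<nu> h x)"
  unfolding jump_op_def
  using integrable_jump[OF assms(1,3,4)] integrable_jump[OF assms(2,3,4)]
  by (simp add: add_diff_add flip: Bochner_Integration.integral_add)

lemma jump_op_uminus: "jump_op \<nu> (\<lambda>x. - g x) = (\<lambda>x. - jump_op \<nu> g x)"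
  unfolding jump_op_def by (simp flip: Bochner_Integration.integral_minus)

lemma jump_op_diff:
  assumes "hoelder \<beta> K g" "hoelder \<beta> K' h" "0 < \<beta>" "\<beta> \<le> 1"
  shows "jump_op \<nu> (\<lambda>x. g x - h x) = (\<lambda>x. jump_op \<nu> g x - jump_op \<nu> h x)"
  using jump_op_add[OF assms(1) hoelder_uminus[OF assms(2)] assms(3,4)]
  by (simp add: jump_op_uminus)

lemma jump_op_bound:
  assumes "hoelder \<beta> K g" "0 < \<beta>" "\<beta> \<le> 1"
  shows "\<bar>jump_op \<nu> g x\<bar> \<le> K * moment \<beta>"
proof -
  have "\<bar>jump_op \<nu> g x\<bar> \<le> (LINT y|\<nu>. K * cut_norm y powr \<beta>)"
    unfolding jump_op_def real_norm_def[symmetric]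
    using integrable_cut_norm_powr[of \<beta>] assms hoelder_shift[OF assms(1)]
    by (intro Bochner_Integration.integral_norm_bound_integral integrable_jump[OF assms]) auto
  then show ?thesis by (simp add: moment_def)
qed

text \<open>The second difference of $g$ is at most $2K \min(m(x-x'), m(y))^\beta$, because it can be read as a
  difference of increments in $y$ or in $x - x'$. Splitting the exponent as $(\beta-\epsilon)+\epsilon$
  distributes it over the two factors, and only $m(y)^\epsilon$ remains to be integrated.\<close>

lemma jump_op_hoelder:
  assumes g: "hoelder \<beta> K g" and "\<beta> \<le> 1" "0 < \<epsilon>" "\<epsilon> < \<beta>"
  shows "hoelder (\<beta> - \<epsilon>) (2 * K * moment \<epsilon>) (jump_op \<nu> g)"
  unfolding hoelder_def
proof (intro allI)
  fix x x' :: 'a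
  let ?d = "\<lambda>y. (g (x + y) - g x) - (g (x' + y) - g x')"
  let ?h = "2 * K * cut_norm (x - x') powr (\<beta> - \<epsilon>)"
  have K: "0 \<le> K" by (rule hoelder_nonneg[OF g])
  have int: "integrable \<nu> (\<lambda>y. g (z + y) - g z)" for z
    using assms by (intro integrable_jump[OF g]) auto
  have bound: "\<bar>?d y\<bar> \<le> ?h * cut_norm y powr \<epsilon>" for y
  proof -
    let ?a = "cut_norm (x - x')" and ?b = "cut_norm y"
    \<comment> \<open>bound by the increments in \<open>y\<close> at the two base points\<close>
    have "\<bar>?d y\<bar> \<le> 2 * K * ?b powr \<beta>"
      using hoelder_shift[OF g, of x y] hoelder_shift[OF g, of x' y] by linarith
    \<comment> \<open>bound by the increments from \<open>x'\<close> to \<open>x\<close>, with and without the jump\<close>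
    moreover have "\<bar>?d y\<bar> \<le> 2 * K * ?a powr \<beta>"
    proof -
      have "(x + y) - (x' + y) = x - x'" by simp
      then show ?thesis
        using hoelderD[OF g, of "x + y" "x' + y"] hoelderD[OF g, of x x'] by fastforce
    qed
    ultimately have "\<bar>?d y\<bar> \<le> 2 * K * min ?a ?b powr \<beta>"
      unfolding min_def by metis
    also have "min ?a ?b powr \<beta> = min ?a ?b powr (\<beta> - \<epsilon>) * min ?a ?b powr \<epsilon>"
      by (simp flip: powr_add)
    also have "2 * K * \<dots> \<le> 2 * K * (?a powr (\<beta> - \<epsilon>) * ?b powr \<epsilon>)"
      using assms K by (intro mult_left_mono mult_mono powr_mono2) auto
    finally show ?thesis by (simp add: mult_ac)
  qed
  have "\<bar>jump_op \<nu> g x - jump_op \<nu> g x'\<bar> = norm (LINT y|\<nu>. ?d y)"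
    by (simp add: jump_op_def Bochner_Integration.integral_diff[OF int int])
  also have "\<dots> \<le> (LINT y|\<nu>. ?h * cut_norm y powr \<epsilon>)"
    using integrable_cut_norm_powr[of \<epsilon>] assms bound
    by (intro Bochner_Integration.integral_norm_bound_integral Bochner_Integration.integrable_diff int) auto
  also have "\<dots> = 2 * K * moment \<epsilon> * cut_norm (x - x') powr (\<beta> - \<epsilon>)"
    by (simp add: moment_def)
  finally show "\<bar>jump_op \<nu> g x - jump_op \<nu> g x'\<bar> \<le> \<dots>" .
qed

lemma jump_op_tendsto:
  assumes g: "\<And>n::nat. hoelder \<beta> K (g n)" "hoelder \<beta> K' g'" and \<beta>: "0 < \<beta>" "\<beta> \<le> 1"
    and lim: "\<And>x. (\<lambda>n. g n x) \<longlonglongrightarrow> g' x"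
  shows "(\<lambda>n. jump_op \<nu> (g n) x) \<longlonglongrightarrow> jump_op \<nu> g' x"
  unfolding jump_op_def
proof (rule integral_dominated_convergence[where w = "\<lambda>y. K * cut_norm y powr \<beta>"])
  have [measurable]: "g n \<in> borel_measurable borel" "g' \<in> borel_measurable borel" for n
    using g \<beta> by (blast intro: hoelder_measurable)+
  show "(\<lambda>y. g' (x + y) - g' x) \<in> borel_measurable \<nu>"
    "(\<lambda>y. g n (x + y) - g n x) \<in> borel_measurable \<nu>" for n
    by measurable
qed (use g \<beta> integrable_cut_norm_powr hoelder_shift[OF g(1)] in \<open>auto intro!: tendsto_intros lim\<close>)

lemma jump_op_vanishes_at_infinity:
  assumes g: "hoelder \<beta> K g" and \<beta>: "0 < \<beta>" "\<beta> \<le> 1" and lim: "(g \<longlongrightarrow> 0) at_infinity"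
  shows "(jump_op \<nu> g \<longlongrightarrow> 0) at_infinity"
proof (rule ccontr)
  assume "\<not> (jump_op \<nu> g \<longlongrightarrow> 0) at_infinity"
  then obtain e where e: "e > 0" and "\<not> (\<exists>b. \<forall>x. b \<le> norm x \<longrightarrow> \<bar>jump_op \<nu> g x\<bar> < e)"
    unfolding tendsto_iff eventually_at_infinity dist_real_def diff_0_right by blast
  then have "\<forall>n. \<exists>x. real n \<le> norm x \<and> e \<le> \<bar>jump_op \<nu> g x\<bar>"
    unfolding not_less[symmetric] by blast
  from choice[OF this] obtain X
    where X: "\<And>n. real n \<le> norm (X n)" "\<And>n. e \<le> \<bar>jump_op \<nu> g (X n)\<bar>"
    by blast
  have "filterlim X at_infinity sequentially"
    by (rule filterlim_norm_at_top_imp_at_infinity)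
      (rule filterlim_at_top_mono[OF filterlim_real_sequentially], simp add: X)
  then have "filterlim (\<lambda>n. X n + y) at_infinity sequentially" for y
    by (rule tendsto_add_filterlim_at_infinity'[OF _ tendsto_const])
  then have "(\<lambda>n. g (X n + y)) \<longlonglongrightarrow> 0" for y
    by (rule filterlim_compose[OF lim])
  moreover have "hoelder \<beta> K (\<lambda>y. g (X n + y))" for n
    using \<beta> by (intro hoelder_compose_contraction[OF g, of "(+) (X n)"]) auto
  moreover have "hoelder \<beta> 0 (\<lambda>x. 0)"
    by (simp add: hoelder_def)
  ultimately have "(\<lambda>n. jump_op \<nu> (\<lambda>y. g (X n + y)) 0) \<longlonglongrightarrow> jump_op \<nu> (\<lambda>x. 0) 0"
    using \<beta> by (intro jump_op_tendsto)
  then have "(\<lambda>n. \<bar>jump_op \<nu> g (X n)\<bar>) \<longlonglongrightarrow> 0"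
    by (intro tendsto_rabs_zero) (simp add: jump_op_def)
  then have "e \<le> 0"
    by (rule LIMSEQ_le_const) (use X in auto)
  with e show False by simp
qed

text \<open>At a point where $g$ is within $\frac{1}{n+1}$ of its supremum, no jump gains more than
  $\frac{1}{n+1}$. So $A g$ there is at most
  $\int \min(K m^\beta, \frac{1}{n+1})\,d\nu$, which tends to $0$. The supremum need not be attained,
  which matters for almost periodic functions.\<close>

lemma maximum_principle_upper:
  assumes g: "hoelder \<beta> K g" and \<beta>: "0 < \<beta>" "\<beta> \<le> 1"
    and le: "\<And>x. g x - jump_op \<nu> g x \<le> \<delta>"
  shows "g x \<le> \<delta>"
proof -
  have [measurable]: "g \<in> borel_measurable borel"
    using g \<beta> by (intro hoelder_measurable)
  define S where "S = (SUP x. g x)"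
  have bdd: "bdd_above (range g)"
    using hoelder_bounded[OF g] \<beta> by (intro bdd_aboveI[of _ "\<bar>g 0\<bar> + K"]) (auto simp: abs_le_iff)
  have le_S: "g y \<le> S" for y
    unfolding S_def by (intro cSUP_upper bdd) auto
  have "\<exists>y. S - 1 / (real n + 1) < g y" for n
  proof -
    have "S - 1 / (real n + 1) < S" by simp
    then show ?thesis
      unfolding S_def using bdd by (subst (asm) less_cSUP_iff) auto
  qed
  then obtain X where X: "\<And>n. S - 1 / (real n + 1) < g (X n)" by metis
  let ?w = "\<lambda>n y. min (K * cut_norm y powr \<beta>) (1 / (real n + 1))"
  have dom: "integrable \<nu> (\<lambda>y. K * cut_norm y powr \<beta>)"
    using integrable_cut_norm_powr[of \<beta>] \<beta> by simp
  have K: "0 \<le> K" by (rule hoelder_nonneg[OF g])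
  have int_w: "integrable \<nu> (?w n)" for n
    by (rule Bochner_Integration.integrable_bound[OF dom]) (use K in auto)
  have jump_le: "jump_op \<nu> g (X n) \<le> (LINT y|\<nu>. ?w n y)" for n
    unfolding jump_op_def
  proof (rule integral_mono[OF integrable_jump[OF g \<beta>] int_w])
    fix y
    show "g (X n + y) - g (X n) \<le> ?w n y"
      using hoelder_shift[OF g, of "X n" y] le_S[of "X n + y"] X[of n] by (simp add: abs_le_iff)
  qed
  have "(\<lambda>n. LINT y|\<nu>. ?w n y) \<longlonglongrightarrow> (LINT y|\<nu>. 0)"
  proof (rule integral_dominated_convergence[OF _ _ dom])
    show "AE y in \<nu>. (\<lambda>n. ?w n y) \<longlonglongrightarrow> 0"
    proof (rule AE_I2)
      fix y
      have "(\<lambda>n. ?w n y) \<longlonglongrightarrow> min (K * cut_norm y powr \<beta>) 0"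
        by (intro tendsto_intros) real_asymp
      then show "(\<lambda>n. ?w n y) \<longlonglongrightarrow> 0" using K by (simp add: min_absorb2)
    qed
  qed (use K in auto)
  then have "(\<lambda>n. \<delta> + (LINT y|\<nu>. ?w n y) + 1 / (real n + 1)) \<longlonglongrightarrow> \<delta> + 0 + 0"
    by (intro tendsto_add tendsto_const) (simp, real_asymp)
  then have "S \<le> \<delta> + 0 + 0"
  proof (rule LIMSEQ_le_const, intro exI allI impI)
    fix n
    show "S \<le> \<delta> + (LINT y|\<nu>. ?w n y) + 1 / (real n + 1)"
      using X[of n] jump_le[of n] le[of "X n"] by linarith
  qed
  with le_S[of x] show ?thesis by simp
qed

lemma maximum_principle:
  assumes g: "hoelder \<beta> K g" and \<beta>: "0 < \<beta>" "\<beta> \<le> 1"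
    and le: "\<And>x. \<bar>g x - jump_op \<nu> g x\<bar> \<le> \<delta>"
  shows "\<bar>g x\<bar> \<le> \<delta>"
  using maximum_principle_upper[OF g \<beta>, of \<delta> x]
    maximum_principle_upper[OF hoelder_uminus[OF g] \<beta>, of \<delta> x] le
  by (simp add: jump_op_uminus abs_le_iff)

end

section \<open>Approximation by trigonometric polynomials\<close>

lemma integrable_char_minus_one:
  fixes \<nu> :: "'a::euclidean_space measure"
  assumes [measurable_cong]: "sets \<nu> = sets borel" and int: "integrable \<nu> cut_norm"
  shows "integrable \<nu> (\<lambda>z. 1 - iexp (\<xi> \<bullet> z))"
proof (rule Bochner_Integration.integrable_bound)
  show "integrable \<nu> (\<lambda>z. (2 + norm \<xi>) * cut_norm z)" using int by simp
  show "(\<lambda>z. 1 - iexp (\<xi> \<bullet> z)) \<in> borel_measurable \<nu>" by measurable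
  show "AE z in \<nu>. cmod (1 - iexp (\<xi> \<bullet> z)) \<le> norm ((2 + norm \<xi>) * cut_norm z)"
    using norm_char_diff_le[of \<xi> _ 0] by (simp add: norm_minus_commute)
qed

lemma jump_op_char:
  fixes \<nu> :: "'a::euclidean_space measure"
  assumes "sets \<nu> = sets borel" "integrable \<nu> cut_norm"
  shows "jump_op \<nu> (\<lambda>x. Re (c * iexp (\<xi> \<bullet> x))) =
    (\<lambda>x. Re (- char_exponent \<nu> \<xi> * c * iexp (\<xi> \<bullet> x)))"
proof
  fix x
  have *: "Re (c * iexp (\<xi> \<bullet> (x + y))) - Re (c * iexp (\<xi> \<bullet> x)) =
      Re (- (c * iexp (\<xi> \<bullet> x)) * (1 - iexp (\<xi> \<bullet> y)))" for y
  proof -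
    have "c * iexp (\<xi> \<bullet> (x + y)) - c * iexp (\<xi> \<bullet> x) =
        - (c * iexp (\<xi> \<bullet> x)) * (1 - iexp (\<xi> \<bullet> y))"
      by (simp add: inner_add_right ring_distribs exp_add)
    then show ?thesis
      by (simp only: minus_complex.sel[symmetric])
  qed
  have "jump_op \<nu> (\<lambda>x. Re (c * iexp (\<xi> \<bullet> x))) x =
      Re (CLINT y|\<nu>. - (c * iexp (\<xi> \<bullet> x)) * (1 - iexp (\<xi> \<bullet> y)))"
    unfolding jump_op_def *
    by (intro integral_Re integrable_mult_right integrable_char_minus_one assms)
  also have "\<dots> = Re (- (c * iexp (\<xi> \<bullet> x)) * char_exponent \<nu> \<xi>)"
    unfolding char_exponent_def by (simp only: integral_mult_right_zero)
  finally show "jump_op \<nu> (\<lambda>x. Re (c * iexp (\<xi> \<bullet> x))) x =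
      Re (- char_exponent \<nu> \<xi> * c * iexp (\<xi> \<bullet> x))"
    by (simp add: mult_ac del: minus_complex.sel times_complex.sel uminus_complex.sel)
qed

lemma Re_char_exponent:
  fixes \<nu> :: "'a::euclidean_space measure"
  assumes "sets \<nu> = sets borel" "integrable \<nu> cut_norm"
  shows "Re (char_exponent \<nu> \<xi>) = (LINT z|\<nu>. 1 - cos (\<xi> \<bullet> z))"
proof -
  have "Re (1 - iexp t) = 1 - cos t" for t
    by (simp add: Re_exp)
  then show ?thesis
    unfolding char_exponent_def
    by (simp flip: integral_Re[OF integrable_char_minus_one[OF assms]])
qed

lemma Re_char_exponent_nonneg:
  fixes \<nu> :: "'a::euclidean_space measure"
  assumes "sets \<nu> = sets borel" "integrable \<nu> cut_norm"
  shows "0 \<le> Re (char_exponent \<nu> \<xi>)"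
  unfolding Re_char_exponent[OF assms] by (intro integral_nonneg_AE) auto

context jump_measure
begin

lemma jump_op_trig_poly_add:
  assumes "trig_poly u" "trig_poly v"
  shows "jump_op \<nu> (\<lambda>x. u x + v x) = (\<lambda>x. jump_op \<nu> u x + jump_op \<nu> v x)"
  using trig_poly_hoelder[OF assms(1)] trig_poly_hoelder[OF assms(2)] jump_op_add[of 1]
  by fastforce

lemma jump_op_trig_poly: "trig_poly u \<Longrightarrow> trig_poly (jump_op \<nu> u)"
proof (induction rule: trig_poly.induct)
  case (trig_poly_char c \<xi>)
  show ?case
    unfolding jump_op_char[OF sets_eq_borel integrable_cut_norm] by (rule trig_poly.trig_poly_char)
next
  case (trig_poly_add u v)
  then show ?case by (simp add: jump_op_trig_poly_add trig_poly.trig_poly_add)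
qed

text \<open>On characters one divides by $1 + \psi(\xi)$, whose real part is at least $1$.\<close>

lemma trig_poly_resolvent:
  assumes "trig_poly h"
  shows "\<exists>u. trig_poly u \<and> (\<forall>x. u x - jump_op \<nu> u x = h x)"
  using assms
proof (induction rule: trig_poly.induct)
  case (trig_poly_char c \<xi>)
  define w where "w = 1 + char_exponent \<nu> \<xi>"
  have "Re w \<noteq> 0"
    using Re_char_exponent_nonneg[OF sets_eq_borel integrable_cut_norm, of \<xi>] by (simp add: w_def)
  then have "w \<noteq> 0" by auto
  have "c / w * iexp (\<xi> \<bullet> x) - (- char_exponent \<nu> \<xi>) * (c / w) * iexp (\<xi> \<bullet> x)
      = c / w * w * iexp (\<xi> \<bullet> x)" for x
    unfolding w_def by (simp only: ring_distribs) simp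
  with \<open>w \<noteq> 0\<close> have "c / w * iexp (\<xi> \<bullet> x) - (- char_exponent \<nu> \<xi>) * (c / w) * iexp (\<xi> \<bullet> x)
      = c * iexp (\<xi> \<bullet> x)" for x
    by simp
  then have "Re (c / w * iexp (\<xi> \<bullet> x)) - jump_op \<nu> (\<lambda>x. Re (c / w * iexp (\<xi> \<bullet> x))) x
      = Re (c * iexp (\<xi> \<bullet> x))" for x
    unfolding jump_op_char[OF sets_eq_borel integrable_cut_norm] minus_complex.sel[symmetric] by simp
  then show ?case using trig_poly.trig_poly_char by blast
next
  case (trig_poly_add f g)
  then obtain u v where "trig_poly u" "trig_poly v"
    "\<And>x. u x - jump_op \<nu> u x = f x" "\<And>x. v x - jump_op \<nu> v x = g x"
    by blast
  then show ?case
    by (intro exI[of _ "\<lambda>x. u x + v x"])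
      (auto simp: jump_op_trig_poly_add trig_poly.trig_poly_add add_diff_add)
qed

text \<open>Dropping the jumps smaller than $\frac{1}{n+1}$ changes $A F$ uniformly little by the Hoelder bound.
  What remains is the jump operator of a finite measure, which is bounded in the supremum norm and so
  transfers the approximation of $F$ by trigonometric polynomials; these are mapped to trigonometric
  polynomials again.\<close>

lemma jump_op_uniform_limit_trig_poly:
  assumes F: "hoelder \<beta> K F" and \<beta>: "0 < \<beta>" "\<beta> \<le> 1"
    and approx: "\<And>e. 0 < e \<Longrightarrow> \<exists>q. trig_poly q \<and> (\<forall>x. \<bar>F x - q x\<bar> < e)"
    and e: "0 < e"
  shows "\<exists>q. trig_poly q \<and> (\<forall>x. \<bar>jump_op \<nu> F x - q x\<bar> < e)"
proof -
  define B :: "nat \<Rightarrow> 'a set" where "B n = {y. 1 / (real n + 1) < norm y}" for n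
  have B_meas [measurable]: "B n \<in> sets borel" for n
    unfolding B_def by measurable
  have K: "0 \<le> K" by (rule hoelder_nonneg[OF F])
  let ?w = "\<lambda>n y. K * cut_norm y powr \<beta> * indicator (- B n) y"
  have dom: "integrable \<nu> (\<lambda>y. K * cut_norm y powr \<beta>)"
    using integrable_cut_norm_powr[of \<beta>] \<beta> by simp
  have int_w: "integrable \<nu> (?w n)" for n
    by (rule Bochner_Integration.integrable_bound[OF dom]) (auto simp: abs_mult split: split_indicator)
  have "(\<lambda>n. LINT y|\<nu>. ?w n y) \<longlonglongrightarrow> (LINT y|\<nu>. 0)"
  proof (rule integral_dominated_convergence[OF _ _ dom])
    show "AE y in \<nu>. (\<lambda>n. ?w n y) \<longlonglongrightarrow> 0"
    proof (rule AE_I2)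
      fix y :: 'a
      show "(\<lambda>n. ?w n y) \<longlonglongrightarrow> 0"
      proof (cases "y = 0")
        case False
        have "eventually (\<lambda>n. 1 / (real n + 1) < norm y) sequentially"
          by (rule order_tendstoD[where y = 0]) (use False in \<open>simp_all, real_asymp\<close>)
        then have "eventually (\<lambda>n. ?w n y = 0) sequentially"
          by (rule eventually_mono) (simp add: B_def)
        then show ?thesis by (rule tendsto_eventually)
      qed simp
    qed
  qed (use K in \<open>auto split: split_indicator\<close>)
  then have "eventually (\<lambda>n. (LINT y|\<nu>. ?w n y) < e / 2) sequentially"
    by (rule order_tendstoD) (use e in simp)
  then obtain n where n: "(LINT y|\<nu>. ?w n y) < e / 2"
    by (auto simp: eventually_sequentially)
  have ind: "indicator (B n) y \<le> (real n + 1) * cut_norm y" for y :: 'a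
    by (auto simp: B_def cut_norm_def field_simps min_def split: split_indicator)
  have int_B: "integrable \<nu> (indicator (B n) :: 'a \<Rightarrow> real)"
    by (rule Bochner_Integration.integrable_bound[OF integrable_mult_right[OF integrable_cut_norm, of "real n + 1"]])
      (use ind in auto)
  define c where "c = (LINT y|\<nu>. (indicator (B n) y :: real))"
  have c: "0 \<le> c" unfolding c_def by simp
  define \<eta> where "\<eta> = e / (4 * (c + 1))"
  have \<eta>: "0 < \<eta>" "2 * \<eta> * c < e / 2"
    using e c by (auto simp: \<eta>_def field_simps)
  obtain q where q: "trig_poly q" "\<And>x. \<bar>F x - q x\<bar> < \<eta>"
    using approx[OF \<eta>(1)] by blast
  \<comment> \<open>the jumps of size larger than \<open>1 / (n + 1)\<close>\<close>
  let ?\<mu> = "density \<nu> (indicator (B n))"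
  interpret B: jump_measure ?\<mu>
  proof
    show "sets ?\<mu> = sets borel" using sets_eq_borel by simp
    fix \<alpha> :: real assume \<alpha>: "0 < \<alpha>" "\<alpha> \<le> 1"
    have "integrable \<nu> (\<lambda>z. indicator (B n) z *\<^sub>R cut_norm z powr \<alpha>)"
      by (rule Bochner_Integration.integrable_bound[OF integrable_cut_norm_powr[OF \<alpha>]])
        (auto split: split_indicator)
    then show "integrable ?\<mu> (\<lambda>z. cut_norm z powr \<alpha>)"
      by (subst integrable_density[where g = "indicator (B n)", simplified ennreal_indicator]) auto
  qed
  obtain K' where K': "hoelder 1 K' q" using trig_poly_hoelder[OF q(1)] by blast
  have [measurable]: "q \<in> borel_measurable borel"
    by (rule hoelder_measurable[OF K']) simp
  have close: "\<bar>jump_op \<nu> F x - jump_op ?\<mu> q x\<bar> < e" for x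
  proof -
    let ?d = "\<lambda>y. (F (x + y) - F x) - indicator (B n) y *\<^sub>R (q (x + y) - q x)"
    have 1: "integrable \<nu> (\<lambda>y. F (x + y) - F x)"
      by (rule integrable_jump[OF F \<beta>])
    have 2: "integrable \<nu> (\<lambda>y. indicator (B n) y *\<^sub>R (q (x + y) - q x))"
      by (rule Bochner_Integration.integrable_bound[OF integrable_jump[OF K', of x]])
        (auto split: split_indicator)
    have "jump_op ?\<mu> q x = (LINT y|\<nu>. indicator (B n) y *\<^sub>R (q (x + y) - q x))"
      unfolding jump_op_def
      by (subst integral_density[where g = "indicator (B n)", simplified ennreal_indicator]) auto
    then have "\<bar>jump_op \<nu> F x - jump_op ?\<mu> q x\<bar> = norm (LINT y|\<nu>. ?d y)"
      using Bochner_Integration.integral_diff[OF 1 2] by (simp add: jump_op_def)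
    also have "\<dots> \<le> (LINT y|\<nu>. ?w n y + 2 * \<eta> * indicator (B n) y)"
    proof (rule Bochner_Integration.integral_norm_bound_integral)
      show "integrable \<nu> ?d" using 1 2 by simp
      show "integrable \<nu> (\<lambda>y. ?w n y + 2 * \<eta> * indicator (B n) y)" using int_w int_B by simp
      fix y
      show "norm (?d y) \<le> ?w n y + 2 * \<eta> * indicator (B n) y"
        using hoelder_shift[OF F, of x y] q(2)[of x] q(2)[of "x + y"]
        by (auto split: split_indicator)
    qed
    also have "\<dots> = (LINT y|\<nu>. ?w n y) + 2 * \<eta> * c"
      using int_w int_B by (simp add: c_def)
    also have "\<dots> < e" using n \<eta> by linarith
    finally show ?thesis .
  qed
  then show ?thesis using B.jump_op_trig_poly[OF q(1)] by blast
qed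

text \<open>Simultaneous approximation of $g$ and $A g$, in the mode required by dominated convergence.\<close>

lemma trig_poly_approximation:
  assumes g: "hoelder \<beta> K g" and \<beta>: "0 < \<beta>" "\<beta> \<le> 1"
  shows "\<exists>u C. (\<forall>n::nat. trig_poly (u n)) \<and>
    (\<forall>n x. \<bar>u n x\<bar> \<le> C \<and> \<bar>jump_op \<nu> (u n) x\<bar> \<le> C) \<and>
    (\<forall>x. (\<lambda>n. u n x) \<longlonglongrightarrow> g x \<and> (\<lambda>n. jump_op \<nu> (u n) x) \<longlonglongrightarrow> jump_op \<nu> g x)"
proof -
  define F where "F n x = g (\<Sum>b\<in>Basis. (real (Suc n) * sin ((b /\<^sub>R real (Suc n)) \<bullet> x)) *\<^sub>R b)" for n x
  have F: "hoelder \<beta> K (F n)" for n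
    unfolding F_def
    by (rule hoelder_compose_contraction[OF g _ norm_sin_scaling_le]) (use \<beta> in auto)
  have F_lim: "(\<lambda>n. F n x) \<longlonglongrightarrow> g x" for x
    unfolding F_def
    by (rule continuous_on_tendsto_compose[OF hoelder_continuous[OF g \<beta>(1)] sin_scaling_tendsto]) auto
  have approx_F: "\<exists>q. trig_poly q \<and> (\<forall>x. \<bar>F n x - q x\<bar> < e)" if "0 < e" for n e
    unfolding F_def
    using trig_poly_dense_sin[OF hoelder_continuous[OF g \<beta>(1)] that, of "real (Suc n)"] by metis
  have "\<exists>u. trig_poly u \<and> (\<forall>x. \<bar>u x - F n x\<bar> \<le> 1 / Suc n) \<and>
      (\<forall>x. \<bar>jump_op \<nu> u x - jump_op \<nu> (F n) x\<bar> \<le> 2 / Suc n)" for n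
  proof -
    obtain q where q: "trig_poly q" "\<And>x. \<bar>F n x - q x\<bar> < 1 / (2 * Suc n)"
      using approx_F[of "1 / (2 * Suc n)" n] by auto
    obtain r where r: "trig_poly r" "\<And>x. \<bar>jump_op \<nu> (F n) x - r x\<bar> < 1 / (2 * Suc n)"
      using jump_op_uniform_limit_trig_poly[OF F \<beta> approx_F, where e = "1 / (2 * Suc n)"] by auto
    \<comment> \<open>approximates \<open>F n - A (F n)\<close> up to \<open>1 / Suc n\<close>\<close>
    have "trig_poly (\<lambda>x. q x + (- 1) * r x)"
      by (intro trig_poly_add trig_poly_cmult q(1) r(1))
    then obtain u where u: "trig_poly u" "\<And>x. u x - jump_op \<nu> u x = q x - r x"
      using trig_poly_resolvent by fastforce
    obtain K' where "hoelder 1 K' u" using trig_poly_hoelder[OF u(1)] by blast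
    then have K': "hoelder \<beta> K' u" by (rule hoelder_weaken) (use \<beta> in auto)
    have diff: "jump_op \<nu> (\<lambda>x. u x - F n x) x = jump_op \<nu> u x - jump_op \<nu> (F n) x" for x
      by (simp add: jump_op_diff[OF K' F \<beta>])
    have half: "1 / real (2 * Suc n) + 1 / real (2 * Suc n) = 1 / Suc n"
      by (simp add: field_simps)
    have res: "\<bar>(u x - F n x) - jump_op \<nu> (\<lambda>x. u x - F n x) x\<bar> \<le> 1 / Suc n" for x
    proof -
      have "\<bar>(a - a') - (b - b')\<bar> \<le> d" if "\<bar>a' - c\<bar> < d'" "\<bar>b' - c'\<bar> < d'" "a - b = c - c'" "d' + d' = d"
        for a a' b b' c c' d d' :: real
        using that by linarith
      from this[OF q(2) r(2) u(2) half] show ?thesis unfolding diff .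
    qed
    then have small: "\<bar>u x - F n x\<bar> \<le> 1 / Suc n" for x
      using maximum_principle[OF hoelder_diff[OF K' F[of n]] \<beta>, of "1 / Suc n" x] by blast
    moreover have "\<bar>jump_op \<nu> u x - jump_op \<nu> (F n) x\<bar> \<le> 2 / Suc n" for x
    proof -
      have "2 / real (Suc n) = 1 / Suc n + 1 / Suc n" by simp
      with res[of x] small[of x] show ?thesis unfolding diff by linarith
    qed
    ultimately show ?thesis using u(1) by blast
  qed
  then obtain u where u: "\<And>n. trig_poly (u n)" "\<And>n x. \<bar>u n x - F n x\<bar> \<le> 1 / Suc n"
    "\<And>n x. \<bar>jump_op \<nu> (u n) x - jump_op \<nu> (F n) x\<bar> \<le> 2 / Suc n"
    by metis
  define C where "C = max (1 + \<bar>g 0\<bar> + K) (2 + K * moment \<beta>)"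
  show ?thesis
  proof (intro exI[of _ u] exI[of _ C] conjI allI)
    have F0: "F n 0 = g 0" for n by (simp add: F_def)
    fix n x
    have "1 / real (Suc n) \<le> 1" by simp
    then show "\<bar>u n x\<bar> \<le> C"
      using u(2)[of n x] hoelder_bounded[OF F[of n], of x] \<beta> unfolding C_def F0 by linarith
    have "2 / real (Suc n) \<le> 2" by (simp add: divide_le_eq)
    then show "\<bar>jump_op \<nu> (u n) x\<bar> \<le> C"
      using u(3)[of n x] jump_op_bound[OF F[of n] \<beta>, of x] unfolding C_def by linarith
  next
    fix x
    have "(\<lambda>n. u n x - F n x) \<longlonglongrightarrow> 0"
      by (rule Lim_null_comparison[where g = "\<lambda>n. 1 / real (Suc n)"]) (use u(2) in simp, real_asymp)
    from tendsto_add[OF this F_lim[of x]] show "(\<lambda>n. u n x) \<longlonglongrightarrow> g x" by simp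
    have "(\<lambda>n. jump_op \<nu> (u n) x - jump_op \<nu> (F n) x) \<longlonglongrightarrow> 0"
      by (rule Lim_null_comparison[where g = "\<lambda>n. 2 / real (Suc n)"]) (use u(3) in simp, real_asymp)
    from tendsto_add[OF this jump_op_tendsto[OF F g \<beta> F_lim, of x]]
    show "(\<lambda>n. jump_op \<nu> (u n) x) \<longlonglongrightarrow> jump_op \<nu> g x" by simp
  qed (use u(1) in auto)
qed

end

section \<open>Dynkin's formula\<close>

text \<open>The characteristic function ties $p$ to $\nu$. The measure at time $0$ is specified separately because
  the limit from the right says nothing about it.\<close>

locale jump_semigroup = jump_measure \<nu> for \<nu> :: "'a::euclidean_space measure" +
  fixes p :: "real \<Rightarrow> 'a measure"
  assumes prob: "0 \<le> t \<Longrightarrow> prob_space (p t)"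
    and sets_p: "0 \<le> t \<Longrightarrow> sets (p t) = sets borel"
    and p_zero: "p 0 = return borel 0"
    and weakly_continuous:
      "((\<lambda>t. LINT x|p t. apply_bcontfun (\<phi> :: 'a \<Rightarrow>\<^sub>C real) x) \<longlongrightarrow> apply_bcontfun \<phi> 0) (at_right 0)"
    and char_p: "0 \<le> t \<Longrightarrow>
      (CLINT x|p t. iexp (\<xi> \<bullet> x)) = exp (- complex_of_real t * char_exponent \<nu> \<xi>)"
begin

lemma integrable_p:
  fixes g :: "'a \<Rightarrow> 'b::{banach, second_countable_topology}"
  assumes "0 \<le> t" "continuous_on UNIV g" "\<And>x. norm (g x) \<le> C"
  shows "integrable (p t) g"
proof -
  interpret prob_space "p t" by (rule prob[OF assms(1)])
  have "g \<in> borel_measurable (p t)"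
    using borel_measurable_continuous_onI[OF assms(2)] sets_p[OF assms(1)] by (simp cong: measurable_cong_sets)
  then show ?thesis
    using assms(3) by (intro integrable_const_bound[where B = C]) auto
qed

lemma integral_p_bound:
  fixes g :: "'a \<Rightarrow> 'b::{banach, second_countable_topology}"
  assumes "0 \<le> t" "continuous_on UNIV g" "\<And>x. norm (g x) \<le> C"
  shows "norm (integral\<^sup>L (p t) g) \<le> C"
proof -
  interpret prob_space "p t" by (rule prob[OF assms(1)])
  have "norm (integral\<^sup>L (p t) g) \<le> (LINT y|p t. norm (g y))"
    by (rule integral_norm_bound)
  also have "\<dots> \<le> C"
    by (rule integral_le_const) (auto intro!: integrable_norm integrable_p assms)
  finally show ?thesis .
qed

lemma integrable_p_trig_poly:
  assumes "0 \<le> t" "trig_poly u"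
  shows "integrable (p t) (\<lambda>y. u (x + y))"
proof -
  obtain K where K: "hoelder 1 K u" using trig_poly_hoelder[OF assms(2)] by blast
  show ?thesis
  proof (rule integrable_p[OF assms(1)])
    show "continuous_on UNIV (\<lambda>y. u (x + y))"
      by (rule continuous_on_compose2[OF hoelder_continuous[OF K]]) (auto intro!: continuous_intros)
    show "norm (u (x + y)) \<le> \<bar>u 0\<bar> + K" for y
      using hoelder_bounded[OF K] by simp
  qed
qed

lemma integral_p_char:
  assumes "0 \<le> t"
  shows "(LINT y|p t. Re (c * iexp (\<xi> \<bullet> (x + y)))) =
    Re (c * iexp (\<xi> \<bullet> x) * exp (complex_of_real t * - char_exponent \<nu> \<xi>))"
proof -
  have int: "integrable (p t) (\<lambda>y. iexp (\<xi> \<bullet> y))"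
    by (rule integrable_p[OF assms, where C = 1]) (auto intro!: continuous_intros)
  have "(LINT y|p t. Re (c * iexp (\<xi> \<bullet> (x + y)))) = (LINT y|p t. Re (c * iexp (\<xi> \<bullet> x) * iexp (\<xi> \<bullet> y)))"
    by (simp only: inner_add_right of_real_add ring_distribs exp_add mult.assoc)
  also have "\<dots> = Re (CLINT y|p t. c * iexp (\<xi> \<bullet> x) * iexp (\<xi> \<bullet> y))"
    by (rule integral_Re[OF integrable_mult_right[OF int]])
  also have "\<dots> = Re (c * iexp (\<xi> \<bullet> x) * exp (complex_of_real t * - char_exponent \<nu> \<xi>))"
    by (simp only: integral_mult_right_zero char_p[OF assms] minus_mult_left[symmetric] minus_mult_right)
  finally show ?thesis .
qed

text \<open>For a character this is the fundamental theorem of calculus for $s \mapsto e^{-s\psi(\xi)}$.\<close>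

lemma dynkin_trig_poly:
  assumes "trig_poly u" "0 \<le> t"
  shows "((\<lambda>s. LINT y|p s. jump_op \<nu> u (x + y)) has_integral (LINT y|p t. u (x + y)) - u x) {0..t}"
  using assms(1)
proof (induction rule: trig_poly.induct)
  case (trig_poly_char c \<xi>)
  let ?\<psi> = "char_exponent \<nu> \<xi>"
  let ?d = "c * iexp (\<xi> \<bullet> x)"
  let ?F = "\<lambda>s. Re (?d * exp (complex_of_real s * - ?\<psi>))"
  have "((\<lambda>s. Re (- ?\<psi> * ?d * exp (complex_of_real s * - ?\<psi>))) has_integral ?F t - ?F 0) {0..t}"
  proof (rule fundamental_theorem_of_calculus[OF assms(2)])
    fix s
    have "((\<lambda>z. ?d * exp (z * - ?\<psi>)) has_field_derivative - ?\<psi> * ?d * exp (of_real s * - ?\<psi>)) (at (of_real s))"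
      by (auto intro!: derivative_eq_intros)
    then show "(?F has_vector_derivative Re (- ?\<psi> * ?d * exp (complex_of_real s * - ?\<psi>))) (at s within {0..t})"
      by (rule bounded_linear.has_vector_derivative[OF bounded_linear_Re has_vector_derivative_real_field])
  qed
  then have "((\<lambda>s. Re (- ?\<psi> * ?d * exp (complex_of_real s * - ?\<psi>))) has_integral
      (LINT y|p t. Re (c * iexp (\<xi> \<bullet> (x + y)))) - Re (c * iexp (\<xi> \<bullet> x))) {0..t}"
    by (simp only: integral_p_char[OF assms(2)]) simp
  then show ?case
    by (rule has_integral_eq[rotated])
      (simp only: jump_op_char[OF sets_eq_borel integrable_cut_norm] integral_p_char atLeastAtMost_iff,
        simp only: mult.assoc)
next
  case (trig_poly_add u v)
  have "(LINT y|p t. u (x + y)) - u x + ((LINT y|p t. v (x + y)) - v x) =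
    (LINT y|p t. u (x + y) + v (x + y)) - (u x + v x)"
    using trig_poly_add assms(2) by (simp add: Bochner_Integration.integral_add integrable_p_trig_poly)
  with has_integral_add[OF trig_poly_add.IH]
  have "((\<lambda>s. (LINT y|p s. jump_op \<nu> u (x + y)) + (LINT y|p s. jump_op \<nu> v (x + y))) has_integral
    (LINT y|p t. u (x + y) + v (x + y)) - (u x + v x)) {0..t}" by simp
  then show ?case
    by (rule has_integral_eq[rotated, where f = "\<lambda>s. (LINT y|p s. jump_op \<nu> u (x + y)) + (LINT y|p s. jump_op \<nu> v (x + y))"])
      (use trig_poly_add assms(2) in \<open>auto simp: jump_op_trig_poly_add Bochner_Integration.integral_add
        integrable_p_trig_poly jump_op_trig_poly\<close>)
qed

text \<open>The formula passes to bounded pointwise limits by dominated convergence, first under each $p_s$ and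
  then in $s$.\<close>

lemma dynkin_formula:
  assumes g: "hoelder \<beta> K g" and \<beta>: "0 < \<beta>" "\<beta> \<le> 1" and t: "0 \<le> t"
  shows "((\<lambda>s. LINT y|p s. jump_op \<nu> g (x + y)) has_integral (LINT y|p t. g (x + y)) - g x) {0..t}"
proof -
  obtain u C where u: "\<And>n::nat. trig_poly (u n)"
    "\<And>n x. \<bar>u n x\<bar> \<le> C" "\<And>n x. \<bar>jump_op \<nu> (u n) x\<bar> \<le> C"
    "\<And>x. (\<lambda>n. u n x) \<longlonglongrightarrow> g x" "\<And>x. (\<lambda>n. jump_op \<nu> (u n) x) \<longlonglongrightarrow> jump_op \<nu> g x"
    using trig_poly_approximation[OF g \<beta>] by blast
  have lim: "(\<lambda>n. LINT y|p s. v n (x + y)) \<longlonglongrightarrow> (LINT y|p s. w (x + y))"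
    if s: "0 \<le> s" and v: "\<And>n. trig_poly (v n)" "\<And>n x. \<bar>v n x\<bar> \<le> C" "\<And>x. (\<lambda>n. v n x) \<longlonglongrightarrow> w x"
    for s v w
  proof (rule integral_dominated_convergence[where w = "\<lambda>_. C"])
    interpret prob_space "p s" by (rule prob[OF s])
    show meas: "(\<lambda>y. v n (x + y)) \<in> borel_measurable (p s)" for n
      using integrable_p_trig_poly[OF s v(1)] by (rule borel_measurable_integrable)
    show "(\<lambda>y. w (x + y)) \<in> borel_measurable (p s)"
      by (rule borel_measurable_LIMSEQ_real[OF _ meas]) (rule v(3))
    show "integrable (p s) (\<lambda>_. C)" by simp
  qed (use v in auto)
  let ?f = "\<lambda>n s. LINT y|p s. jump_op \<nu> (u n) (x + y)" and ?g = "\<lambda>s. LINT y|p s. jump_op \<nu> g (x + y)"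
  have int: "(?f n has_integral (LINT y|p t. u n (x + y)) - u n x) {0..t}" for n
    by (rule dynkin_trig_poly[OF u(1) t])
  have bound: "norm (?f n s) \<le> C" if "s \<in> {0..t}" for n s
  proof (rule integral_p_bound)
    obtain K' where "hoelder 1 K' (jump_op \<nu> (u n))"
      using trig_poly_hoelder[OF jump_op_trig_poly[OF u(1)]] by blast
    then have "continuous_on UNIV (jump_op \<nu> (u n))" by (rule hoelder_continuous) simp
    then show "continuous_on UNIV (\<lambda>y. jump_op \<nu> (u n) (x + y))"
      by (rule continuous_on_compose2) (auto intro!: continuous_intros)
  qed (use u that in auto)
  have conv: "(\<lambda>n. ?f n s) \<longlonglongrightarrow> ?g s" if "s \<in> {0..t}" for s
    using that by (intro lim[of s "\<lambda>n. jump_op \<nu> (u n)" "jump_op \<nu> g"] jump_op_trig_poly[OF u(1)] u(3,5)) simp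
  note dc = dominated_convergence[of ?f "{0..t}" "\<lambda>_. C" ?g, OF has_integral_integrable[OF int] _ bound conv]
  have "(\<lambda>n. integral {0..t} (?f n)) \<longlonglongrightarrow> integral {0..t} ?g"
    by (rule dc(2)) (rule integrable_const_ivl)
  moreover have "(\<lambda>n. integral {0..t} (?f n)) \<longlonglongrightarrow> (LINT y|p t. g (x + y)) - g x"
    unfolding integral_unique[OF int] by (intro tendsto_diff lim[of t u g] t u(1,2,4))
  ultimately have "integral {0..t} ?g = (LINT y|p t. g (x + y)) - g x"
    by (rule LIMSEQ_unique)
  moreover have "?g integrable_on {0..t}"
    by (rule dc(1)) (rule integrable_const_ivl)
  ultimately show ?thesis by (simp add: has_integral_iff)
qed

end

section \<open>The generator and the Taylor expansion of the semigroup\<close>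

lemma apply_bcontfun_sum: "apply_bcontfun (\<Sum>i\<in>I. g i) x = (\<Sum>i\<in>I. apply_bcontfun (g i) x)"
  for g :: "'i \<Rightarrow> 'a::topological_space \<Rightarrow>\<^sub>C real"
  by (induction I rule: infinite_finite_induct) auto

text \<open>The Hoelder constant bounds the oscillation, and $h$ takes values arbitrarily close to $0$.\<close>

lemma hoelder_C0_norm_le:
  fixes h :: "'a::euclidean_space \<Rightarrow>\<^sub>C real"
  assumes "h \<in> C0" "hoelder \<beta> K (apply_bcontfun h)" "0 \<le> \<beta>"
  shows "norm h \<le> K"
proof (rule norm_bound)
  fix x
  have "(apply_bcontfun h \<longlongrightarrow> 0) at_infinity" using assms(1) by (simp add: C0_def)
  then have "((\<lambda>y. \<bar>h y\<bar> + K) \<longlongrightarrow> \<bar>0\<bar> + K) at_infinity"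
    by (intro tendsto_intros)
  moreover have "\<forall>\<^sub>F y in at_infinity. \<bar>h x\<bar> \<le> \<bar>h y\<bar> + K"
  proof (rule always_eventually, rule allI)
    fix y show "\<bar>h x\<bar> \<le> \<bar>h y\<bar> + K"
      using hoelder_osc[OF assms(2,3), of x y] by linarith
  qed
  ultimately have "\<bar>h x\<bar> \<le> \<bar>0\<bar> + K"
    by (rule tendsto_lowerbound) (rule trivial_limit_at_infinity)
  then show "norm (h x) \<le> K" by simp
qed

text \<open>The left-hand side is a single term of the exponential series of $n$.\<close>

lemma power_self_le_exp_fact: "real n ^ n / fact n \<le> exp 1 ^ n"
proof -
  have "real n ^ n / fact n = (\<Sum>k\<in>{n}. real n ^ k /\<^sub>R fact k)"
    by (simp add: divide_inverse mult.commute)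
  also have "\<dots> \<le> (\<Sum>k. real n ^ k /\<^sub>R fact k)"
    by (rule sum_le_suminf[OF summable_exp_generic]) auto
  also have "\<dots> = exp (real n)" by (simp add: exp_def)
  also have "\<dots> = exp 1 ^ n" by (simp flip: exp_of_nat_mult)
  finally show ?thesis .
qed

lemma has_integral_monomial:
  assumes "0 \<le> t"
  shows "((\<lambda>s. s ^ k / fact k * c) has_integral t ^ Suc k / fact (Suc k) * c) {0..t::real}"
proof -
  have "((\<lambda>s. s ^ k / fact k * c) has_integral t ^ Suc k / fact (Suc k) * c - 0 ^ Suc k / fact (Suc k) * c) {0..t}"
  proof (rule fundamental_theorem_of_calculus[OF assms])
    fix s :: real
    have k: "1 + real k \<noteq> 0" "fact (Suc k) = (1 + real k) * fact k" by auto
    have "((\<lambda>s. s ^ Suc k / fact (Suc k) * c) has_real_derivative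
        (1 + real k) * (1 * s ^ k) / fact (Suc k) * c) (at s within {0..t})"
      by (intro DERIV_cmult_right DERIV_cdivide DERIV_power_Suc DERIV_ident)
    also have "(1 + real k) * (1 * s ^ k) / fact (Suc k) * c = s ^ k / fact k * c"
      unfolding k(2) using k(1) by simp
    finally have "((\<lambda>s. s ^ Suc k / fact (Suc k) * c) has_real_derivative s ^ k / fact k * c) (at s within {0..t})" .
    then show "((\<lambda>s. s ^ Suc k / fact (Suc k) * c) has_vector_derivative s ^ k / fact k * c) (at s within {0..t})"
      by (simp add: has_real_derivative_iff_has_vector_derivative)
  qed
  then show ?thesis by simp
qed

text \<open>Leaving the exponent unspecified makes this class invariant under the jump operator.\<close>

definition hoelder_vanishing :: "('a::euclidean_space \<Rightarrow>\<^sub>C real) \<Rightarrow> bool" where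
  "hoelder_vanishing g \<longleftrightarrow>
    g \<in> C0 \<and> (\<exists>\<beta> K. 0 < \<beta> \<and> \<beta> \<le> 1 \<and> hoelder \<beta> K (apply_bcontfun g))"

context jump_measure
begin

definition jump_bcontfun :: "('a \<Rightarrow>\<^sub>C real) \<Rightarrow> ('a \<Rightarrow>\<^sub>C real)" where
  "jump_bcontfun g = Bcontfun (jump_op \<nu> (apply_bcontfun g))"

lemma apply_jump_bcontfun:
  assumes "hoelder_vanishing g"
  shows "apply_bcontfun (jump_bcontfun g) = jump_op \<nu> (apply_bcontfun g)"
proof -
  obtain \<beta> K where g: "hoelder \<beta> K (apply_bcontfun g)" and \<beta>: "0 < \<beta>" "\<beta> \<le> 1"
    using assms by (auto simp: hoelder_vanishing_def)
  have "hoelder (\<beta> - \<beta> / 2) (2 * K * moment (\<beta> / 2)) (jump_op \<nu> (apply_bcontfun g))"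
    using \<beta> by (intro jump_op_hoelder[OF g]) auto
  then have "continuous_on UNIV (jump_op \<nu> (apply_bcontfun g))"
    by (rule hoelder_continuous) (use \<beta> in simp)
  then have "jump_op \<nu> (apply_bcontfun g) \<in> bcontfun"
    using jump_op_bound[OF g \<beta>] by (intro bcontfun_normI) auto
  then show ?thesis unfolding jump_bcontfun_def by (rule Bcontfun_inverse)
qed

lemma jump_bcontfun_C0:
  assumes "hoelder_vanishing g"
  shows "jump_bcontfun g \<in> C0"
  using assms jump_op_vanishes_at_infinity
  unfolding C0_def mem_Collect_eq apply_jump_bcontfun[OF assms]
  by (auto simp: hoelder_vanishing_def C0_def)

lemma jump_bcontfun_hoelder:
  assumes "hoelder_vanishing g" "hoelder \<beta> K (apply_bcontfun g)" "\<beta> \<le> 1" "0 < \<epsilon>" "\<epsilon> < \<beta>"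
  shows "hoelder (\<beta> - \<epsilon>) (2 * K * moment \<epsilon>) (apply_bcontfun (jump_bcontfun g))"
  unfolding apply_jump_bcontfun[OF assms(1)] by (rule jump_op_hoelder[OF assms(2-5)])

lemma hoelder_vanishing_jump_bcontfun:
  assumes "hoelder_vanishing g"
  shows "hoelder_vanishing (jump_bcontfun g)"
proof -
  obtain \<beta> K where g: "hoelder \<beta> K (apply_bcontfun g)" and \<beta>: "0 < \<beta>" "\<beta> \<le> 1"
    using assms by (auto simp: hoelder_vanishing_def)
  have "hoelder (\<beta> - \<beta> / 2) (2 * K * moment (\<beta> / 2)) (apply_bcontfun (jump_bcontfun g))"
    using \<beta> by (intro jump_bcontfun_hoelder[OF assms g]) auto
  with \<beta> show ?thesis
    unfolding hoelder_vanishing_def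
    by (intro conjI jump_bcontfun_C0 assms exI[of _ "\<beta> - \<beta> / 2"] exI) auto
qed

lemma hoelder_vanishing_iterate:
  "hoelder_vanishing g \<Longrightarrow> hoelder_vanishing ((jump_bcontfun ^^ k) g)"
  by (induction k) (auto intro: hoelder_vanishing_jump_bcontfun)

text \<open>In $n$ steps each application of the operator may spend $\epsilon = \beta/(2n)$ of regularity, at the
  price of a factor $2M/\epsilon = 4Mn/\beta$. The exponent $\beta/2$ is left at the end, and the
  final Hoelder constant bounds the supremum norm.\<close>

lemma norm_iterate_le:
  assumes f: "f \<in> C0" "hoelder \<beta> K (apply_bcontfun f)" and \<beta>: "0 < \<beta>" "\<beta> \<le> 1"
    and M: "\<And>\<epsilon>. 0 < \<epsilon> \<Longrightarrow> \<epsilon> \<le> 1 \<Longrightarrow> moment \<epsilon> \<le> M / \<epsilon>"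
  shows "norm ((jump_bcontfun ^^ n) f) \<le> K * (4 * M * n / \<beta>) ^ n"
proof (cases "n = 0")
  case True
  with hoelder_C0_norm_le[OF f] \<beta> show ?thesis by simp
next
  case False
  define \<epsilon> where "\<epsilon> = \<beta> / (2 * n)"
  have \<epsilon>: "0 < \<epsilon>" "\<epsilon> \<le> 1" "real n * \<epsilon> = \<beta> / 2"
    using False \<beta> by (auto simp: \<epsilon>_def divide_le_eq)
  have hv: "hoelder_vanishing f"
    using f \<beta> by (auto simp: hoelder_vanishing_def)
  have step: "hoelder (\<beta> - real k * \<epsilon>) (K * (2 * M / \<epsilon>) ^ k) (apply_bcontfun ((jump_bcontfun ^^ k) f))"
    if "k \<le> n" for k
    using that
  proof (induction k)
    case 0
    then show ?case using f by simp
  next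
    case (Suc k)
    let ?\<gamma> = "\<beta> - real k * \<epsilon>" and ?K = "K * (2 * M / \<epsilon>) ^ k"
    have IH: "hoelder ?\<gamma> ?K (apply_bcontfun ((jump_bcontfun ^^ k) f))"
      using Suc by simp
    have "real (Suc k) * \<epsilon> \<le> real n * \<epsilon>"
      using Suc \<epsilon> by (intro mult_right_mono) auto
    then have lt: "\<epsilon> < ?\<gamma>" "?\<gamma> \<le> 1"
      using \<epsilon> \<beta> by (auto simp: algebra_simps intro: add_increasing2)
    have "hoelder (?\<gamma> - \<epsilon>) (2 * ?K * moment \<epsilon>) (apply_bcontfun (jump_bcontfun ((jump_bcontfun ^^ k) f)))"
      using lt \<epsilon> by (intro jump_bcontfun_hoelder[OF hoelder_vanishing_iterate[OF hv] IH])
    then have "hoelder (\<beta> - real (Suc k) * \<epsilon>) (K * (2 * M / \<epsilon>) ^ Suc k)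
        (apply_bcontfun (jump_bcontfun ((jump_bcontfun ^^ k) f)))"
    proof (rule hoelder_weaken)
      show "\<beta> - real (Suc k) * \<epsilon> \<le> ?\<gamma> - \<epsilon>" by (simp add: algebra_simps)
      have "2 * ?K * moment \<epsilon> \<le> 2 * ?K * (M / \<epsilon>)"
        using hoelder_nonneg[OF IH] \<epsilon> by (intro mult_left_mono M) auto
      then show "2 * ?K * moment \<epsilon> \<le> K * (2 * M / \<epsilon>) ^ Suc k" by (simp add: mult_ac)
    qed
    then show ?case by simp
  qed
  have "norm ((jump_bcontfun ^^ n) f) \<le> K * (2 * M / \<epsilon>) ^ n"
    using hoelder_vanishing_iterate[OF hv, of n] \<epsilon> \<beta>
    by (intro hoelder_C0_norm_le[OF _ step]) (auto simp: hoelder_vanishing_def)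
  also have "2 * M / \<epsilon> = 4 * M * n / \<beta>"
    using \<beta> False by (simp add: \<epsilon>_def field_simps)
  finally show ?thesis .
qed

end

context jump_semigroup
begin

lemma apply_transition: "0 \<le> t \<Longrightarrow> apply_bcontfun (transition_op (p t) g) x = (LINT y|p t. g (x + y))"
  by (rule apply_transition_op[OF prob sets_p])

lemma norm_transition_le:
  assumes "0 \<le> t"
  shows "norm (transition_op (p t) g) \<le> norm g"
proof (rule norm_bound)
  fix x
  have "continuous_on UNIV (\<lambda>y. g (x + y))"
    by (rule continuous_on_compose2[of UNIV "apply_bcontfun g"]) (auto intro!: continuous_intros)
  then show "norm (transition_op (p t) g x) \<le> norm g"
    unfolding apply_transition[OF assms] by (rule integral_p_bound[OF assms]) (rule norm_bounded)
qed

lemma transition_formula: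
  assumes g: "hoelder_vanishing g" and t: "0 \<le> t"
  shows "((\<lambda>s. transition_op (p s) (jump_bcontfun g) x) has_integral transition_op (p t) g x - g x) {0..t}"
proof -
  obtain \<beta> K where "hoelder \<beta> K (apply_bcontfun g)" "0 < \<beta>" "\<beta> \<le> 1"
    using g by (auto simp: hoelder_vanishing_def)
  from dynkin_formula[OF this t, of x]
  have "((\<lambda>s. LINT y|p s. jump_bcontfun g (x + y)) has_integral transition_op (p t) g x - g x) {0..t}"
    by (simp add: apply_transition[OF t] apply_jump_bcontfun[OF g])
  then show ?thesis
    by (rule has_integral_eq[rotated]) (simp add: apply_transition)
qed

lemma moment_p_small:
  assumes "0 < \<beta>" "0 < e"
  shows "\<exists>d>0. \<forall>s\<in>{0..<d}. (LINT y|p s. cut_norm y powr \<beta>) < e"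
proof -
  define \<phi> :: "'a \<Rightarrow>\<^sub>C real" where "\<phi> = Bcontfun (\<lambda>y. cut_norm y powr \<beta>)"
  have cont: "continuous_on UNIV (\<lambda>y::'a. cut_norm y powr \<beta>)"
    using assms(1) by (intro continuous_on_powr' continuous_intros) auto
  then have "(\<lambda>y::'a. cut_norm y powr \<beta>) \<in> bcontfun"
    using assms(1) by (intro bcontfun_normI[where b = 1]) auto
  then have \<phi>: "apply_bcontfun \<phi> = (\<lambda>y. cut_norm y powr \<beta>)"
    unfolding \<phi>_def by (rule Bcontfun_inverse)
  have "((\<lambda>s. LINT y|p s. cut_norm y powr \<beta>) \<longlongrightarrow> 0) (at_right 0)"
    using weakly_continuous[of \<phi>] by (simp add: \<phi>)
  then have "\<forall>\<^sub>F s in at_right 0. (LINT y|p s. cut_norm y powr \<beta>) < e"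
    by (rule order_tendstoD) (rule assms(2))
  then obtain d where d: "0 < d" "\<And>s. 0 < s \<Longrightarrow> s < d \<Longrightarrow> (LINT y|p s. cut_norm y powr \<beta>) < e"
    unfolding eventually_at_right_field by auto
  have "(LINT y|p 0. cut_norm y powr \<beta>) = 0"
    unfolding p_zero by (subst integral_return) auto
  with assms(2) d show ?thesis by (metis atLeastLessThan_iff less_le)
qed

text \<open>The displacement of $h$ is at most $K\int m^\beta\,dp_s$, and $m^\beta$ is itself a bounded
  continuous function that is $0$ at the origin, so weak continuity of $p_s$ suffices.\<close>

lemma strong_continuity:
  assumes h: "hoelder_vanishing h" and e: "0 < e"
  shows "\<exists>d>0. \<forall>s\<in>{0..<d}. \<forall>x. \<bar>transition_op (p s) h x - h x\<bar> \<le> e"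
proof -
  obtain \<beta> K where hK: "hoelder \<beta> K (apply_bcontfun h)" and \<beta>: "0 < \<beta>" "\<beta> \<le> 1"
    using h by (auto simp: hoelder_vanishing_def)
  have K: "0 \<le> K" by (rule hoelder_nonneg[OF hK])
  obtain d where d: "d > 0" "\<And>s. s \<in> {0..<d} \<Longrightarrow> (LINT y|p s. cut_norm y powr \<beta>) < e / (K + 1)"
    using moment_p_small[OF \<beta>(1), of "e / (K + 1)"] e K by auto
  have "\<bar>transition_op (p s) h x - h x\<bar> \<le> e" if s: "s \<in> {0..<d}" for s x
  proof -
    have s0: "0 \<le> s" using s by simp
    interpret prob_space "p s" by (rule prob[OF s0])
    have cont: "continuous_on UNIV (\<lambda>y. h (x + y))"
      by (rule continuous_on_compose2[of UNIV "apply_bcontfun h"]) (auto intro!: continuous_intros)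
    have int1: "integrable (p s) (\<lambda>y. h (x + y))"
      by (rule integrable_p[OF s0 cont]) (rule norm_bounded)
    have int2: "integrable (p s) (\<lambda>y. K * cut_norm y powr \<beta>)"
      using \<beta> by (intro integrable_mult_right integrable_p[OF s0, where C = 1] continuous_on_powr' continuous_intros) auto
    have "\<bar>transition_op (p s) h x - h x\<bar> = norm (LINT y|p s. h (x + y) - h x)"
      using int1 by (simp add: apply_transition[OF s0] prob_space)
    also have "\<dots> \<le> (LINT y|p s. K * cut_norm y powr \<beta>)"
      using int1 int2 hoelder_shift[OF hK, of x]
      by (intro Bochner_Integration.integral_norm_bound_integral) auto
    also have "\<dots> = K * (LINT y|p s. cut_norm y powr \<beta>)" by simp
    also have "\<dots> \<le> (K + 1) * (e / (K + 1))"
      using d(2)[OF s] K by (intro mult_mono) (auto intro: integral_nonneg_AE)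
    also have "\<dots> = e" using K by simp
    finally show ?thesis .
  qed
  with d(1) show ?thesis by blast
qed

text \<open>By the integral formula the quotient is the mean over $[0,t]$ of $P_s A g$, which is uniformly close
  to $A g$ for small $s$.\<close>

lemma difference_quotient_tendsto:
  assumes g: "hoelder_vanishing g"
  shows "((\<lambda>t. (transition_op (p t) g - g) /\<^sub>R t) \<longlongrightarrow> jump_bcontfun g) (at_right 0)"
proof (rule tendstoI)
  fix e :: real assume e: "0 < e"
  obtain d where d: "0 < d"
    "\<And>s x. s \<in> {0..<d} \<Longrightarrow> \<bar>transition_op (p s) (jump_bcontfun g) x - jump_bcontfun g x\<bar> \<le> e / 2"
    using strong_continuity[OF hoelder_vanishing_jump_bcontfun[OF g], of "e / 2"] e by auto
  have "dist ((transition_op (p t) g - g) /\<^sub>R t) (jump_bcontfun g) < e" if t: "0 < t" "t < d" for t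
  proof -
    have "norm ((transition_op (p t) g - g) /\<^sub>R t - jump_bcontfun g) \<le> e / 2"
    proof (rule norm_bound)
      fix x
      let ?D = "transition_op (p t) g x - g x"
      have "((\<lambda>s. jump_bcontfun g x) has_integral t * jump_bcontfun g x) {0..t}"
        using has_integral_const_real[of "jump_bcontfun g x" 0 t] t by simp
      from has_integral_diff[OF transition_formula[OF g] this, of x] t
      have int: "((\<lambda>s. transition_op (p s) (jump_bcontfun g) x - jump_bcontfun g x) has_integral
          ?D - t * jump_bcontfun g x) {0..t}"
        by simp
      have "norm (?D - t * jump_bcontfun g x) \<le> e / 2 * measure lborel {0..t}"
        using d(2) e t by (intro has_integral_bound_real[OF _ _ int, where S = "{}"]) auto
      then have "\<bar>?D - t * jump_bcontfun g x\<bar> / t \<le> e / 2"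
        using t by (simp add: divide_le_eq)
      moreover have "((transition_op (p t) g - g) /\<^sub>R t - jump_bcontfun g) x =
          (?D - t * jump_bcontfun g x) / t"
        using t by (simp add: field_simps)
      ultimately show "norm (((transition_op (p t) g - g) /\<^sub>R t - jump_bcontfun g) x) \<le> e / 2"
        by (simp only: real_norm_def abs_div_pos[OF t(1)])
    qed
    with e show ?thesis by (simp add: dist_norm)
  qed
  with d(1) show "\<forall>\<^sub>F t in at_right 0. dist ((transition_op (p t) g - g) /\<^sub>R t) (jump_bcontfun g) < e"
    unfolding eventually_at_right_field by auto
qed

lemma generator_domain_hoelder:
  assumes "hoelder_vanishing g"
  shows "g \<in> generator_domain (\<lambda>t. transition_op (p t))"
  using assms difference_quotient_tendsto[OF assms] jump_bcontfun_C0[OF assms]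
  by (auto simp: generator_domain_def hoelder_vanishing_def)

lemma generator_hoelder:
  assumes "hoelder_vanishing g"
  shows "generator (\<lambda>t. transition_op (p t)) g = jump_bcontfun g"
  unfolding generator_def
  by (rule tendsto_Lim[OF _ difference_quotient_tendsto[OF assms]]) simp

lemma generator_iterate:
  assumes "hoelder_vanishing g"
  shows "(generator (\<lambda>t. transition_op (p t)) ^^ k) g = (jump_bcontfun ^^ k) g"
  by (induction k) (simp_all add: generator_hoelder hoelder_vanishing_iterate assms)

text \<open>The remainder of order $n+1$ for $g$ is the time integral of the remainder of order $n$ for $A g$.\<close>

lemma taylor_remainder:
  assumes "hoelder_vanishing g" "0 \<le> t"
  shows "norm (transition_op (p t) g - (\<Sum>k<n. (t ^ k / fact k) *\<^sub>R (jump_bcontfun ^^ k) g))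
    \<le> t ^ n / fact n * norm ((jump_bcontfun ^^ n) g)"
  using assms
proof (induction n arbitrary: g t)
  case 0
  then show ?case using norm_transition_le by simp
next
  case (Suc n)
  let ?h = "jump_bcontfun g"
  let ?R = "\<lambda>s. transition_op (p s) ?h - (\<Sum>k<n. (s ^ k / fact k) *\<^sub>R (jump_bcontfun ^^ k) ?h)"
  let ?N = "norm ((jump_bcontfun ^^ Suc n) g)"
  have shift: "(jump_bcontfun ^^ k) ?h = (jump_bcontfun ^^ Suc k) g" for k
    by (simp only: funpow_Suc_right comp_def)
  show ?case
  proof (rule norm_bound)
    fix x
    let ?S = "\<Sum>k<n. t ^ Suc k / fact (Suc k) * (jump_bcontfun ^^ Suc k) g x"
    have "((\<lambda>s. transition_op (p s) ?h x - (\<Sum>k<n. s ^ k / fact k * (jump_bcontfun ^^ Suc k) g x))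
        has_integral transition_op (p t) g x - g x - ?S) {0..t}"
      using Suc.prems
      by (intro has_integral_diff has_integral_sum transition_formula has_integral_monomial) auto
    then have int: "((\<lambda>s. ?R s x) has_integral transition_op (p t) g x - g x - ?S) {0..t}"
      by (simp only: minus_bcontfun.rep_eq apply_bcontfun_sum scaleR_bcontfun.rep_eq real_scaleR_def shift)
    note mono = has_integral_monomial[OF Suc.prems(2), of n ?N]
    have "norm (integral {0..t} (\<lambda>s. ?R s x)) \<le> integral {0..t} (\<lambda>s. s ^ n / fact n * ?N)"
    proof (rule Henstock_Kurzweil_Integration.integral_norm_bound_integral)
      show "norm (?R s x) \<le> s ^ n / fact n * ?N" if "s \<in> {0..t}" for s
      proof -
        have "norm (?R s x) \<le> norm (?R s)" by (rule norm_bounded)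
        also have "\<dots> \<le> s ^ n / fact n * norm ((jump_bcontfun ^^ n) ?h)"
          using that Suc.prems by (intro Suc.IH hoelder_vanishing_jump_bcontfun) auto
        finally show ?thesis by (simp only: shift)
      qed
    qed (use int mono in \<open>blast intro: has_integral_integrable\<close>)+
    then have le: "norm (transition_op (p t) g x - g x - ?S) \<le> t ^ Suc n / fact (Suc n) * ?N"
      by (simp only: integral_unique[OF int] integral_unique[OF mono])
    have "(transition_op (p t) g - (\<Sum>k<Suc n. (t ^ k / fact k) *\<^sub>R (jump_bcontfun ^^ k) g)) x
        = transition_op (p t) g x - g x - ?S"
      unfolding sum.lessThan_Suc_shift
      by (simp add: apply_bcontfun_sum del: funpow.simps fact_Suc power_Suc)
    then show "norm ((transition_op (p t) g - (\<Sum>k<Suc n. (t ^ k / fact k) *\<^sub>R (jump_bcontfun ^^ k) g)) x)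
        \<le> t ^ Suc n / fact (Suc n) * ?N"
      using le by simp
  qed
qed

lemma exponential_series:
  assumes f: "f \<in> C0" "hoelder \<beta> K (apply_bcontfun f)" and \<beta>: "0 < \<beta>" "\<beta> \<le> 1"
    and M: "0 \<le> M" "\<And>\<epsilon>. 0 < \<epsilon> \<Longrightarrow> \<epsilon> \<le> 1 \<Longrightarrow> moment \<epsilon> \<le> M / \<epsilon>"
    and t: "0 \<le> t" "4 * exp 1 * M * t < \<beta>"
  shows "(\<lambda>k. (t ^ k / fact k) *\<^sub>R (jump_bcontfun ^^ k) f) sums transition_op (p t) f"
proof -
  let ?r = "4 * exp 1 * M * t / \<beta>"
  have hv: "hoelder_vanishing f" using f \<beta> by (auto simp: hoelder_vanishing_def)
  have K: "0 \<le> K" by (rule hoelder_nonneg[OF f(2)])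
  have "norm ((\<Sum>k<n. (t ^ k / fact k) *\<^sub>R (jump_bcontfun ^^ k) f) - transition_op (p t) f) \<le> K * ?r ^ n" for n
  proof -
    have "norm ((\<Sum>k<n. (t ^ k / fact k) *\<^sub>R (jump_bcontfun ^^ k) f) - transition_op (p t) f)
        \<le> t ^ n / fact n * norm ((jump_bcontfun ^^ n) f)"
      using taylor_remainder[OF hv t(1), of n] by (simp add: norm_minus_commute)
    also have "\<dots> \<le> t ^ n / fact n * (K * (4 * M * n / \<beta>) ^ n)"
      using t by (intro mult_left_mono norm_iterate_le[OF f \<beta> M(2)]) auto
    also have "\<dots> = K * (4 * M * t / \<beta>) ^ n * (real n ^ n / fact n)"
      by (simp add: power_mult_distrib power_divide mult_ac)
    also have "\<dots> \<le> K * (4 * M * t / \<beta>) ^ n * exp 1 ^ n"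
      using K M t \<beta> by (intro mult_left_mono power_self_le_exp_fact) auto
    also have "\<dots> = K * ?r ^ n"
      by (simp add: power_mult_distrib power_divide)
    finally show ?thesis .
  qed
  moreover have "(\<lambda>n. K * ?r ^ n) \<longlonglongrightarrow> 0"
  proof -
    have "norm ?r < 1" using t M \<beta> by (simp add: abs_mult)
    then have "(\<lambda>n. ?r ^ n) \<longlonglongrightarrow> 0" by (rule LIMSEQ_power_zero)
    from tendsto_mult_right_zero[OF this, of K] show ?thesis .
  qed
  ultimately have "(\<lambda>n. (\<Sum>k<n. (t ^ k / fact k) *\<^sub>R (jump_bcontfun ^^ k) f) - transition_op (p t) f) \<longlonglongrightarrow> 0"
    by (rule Lim_null_comparison[OF always_eventually, OF allI])
  then show ?thesis unfolding sums_def by (rule LIM_zero_cancel)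
qed

end

section \<open>Moments of the jump measure\<close>

text \<open>Sigma-finiteness is needed for Tonelli's theorem below.\<close>

lemma sigma_finite_jump_measure:
  fixes \<nu> :: "'a::euclidean_space measure"
  assumes sets: "sets \<nu> = sets borel" and zero: "emeasure \<nu> {0} = 0"
    and int: "integrable \<nu> cut_norm"
  shows "sigma_finite_measure \<nu>"
proof
  have space: "space \<nu> = UNIV" using sets_eq_imp_space_eq[OF sets] by simp
  define B :: "nat \<Rightarrow> 'a set" where "B n = {y. 1 / (real n + 1) < norm y}" for n
  have B [measurable]: "B n \<in> sets \<nu>" for n
    unfolding sets B_def by measurable
  have fin: "emeasure \<nu> (B n) \<noteq> \<infinity>" for n
  proof -
    have "indicator (B n) y \<le> (real n + 1) * cut_norm y" for y :: 'a
      by (auto simp: B_def cut_norm_def field_simps min_def split: split_indicator)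
    then have "integrable \<nu> (indicator (B n) :: 'a \<Rightarrow> real)"
      by (intro Bochner_Integration.integrable_bound[OF integrable_mult_right[OF int, of "real n + 1"]]) auto
    then show ?thesis
      by (simp add: integrable_indicator_iff space)
  qed
  have "x \<in> {0} \<union> (\<Union>n. B n)" for x
  proof (cases "x = 0")
    case False
    then obtain n where "inverse (real (Suc n)) < norm x"
      using reals_Archimedean[of "norm x"] by auto
    then show ?thesis by (auto simp: B_def divide_inverse add.commute)
  qed simp
  then have "\<Union>(insert {0} (range B)) = space \<nu>"
    by (auto simp: space)
  then show "\<exists>A. countable A \<and> A \<subseteq> sets \<nu> \<and> \<Union>A = space \<nu> \<and> (\<forall>a\<in>A. emeasure \<nu> a \<noteq> \<infinity>)"
    using fin zero B sets by (intro exI[of _ "insert {0} (range B)"]) auto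
qed

text \<open>The point is that the supremum defining $\psi^*$ is taken over a bounded set, as
  $|\psi(\xi)| \le (2 + |\xi|)\int m\,d\nu$.\<close>

lemma Re_char_exponent_le_psi_star:
  fixes \<nu> :: "'a::euclidean_space measure"
  assumes "sets \<nu> = sets borel" "integrable \<nu> cut_norm" "norm \<xi> \<le> r"
  shows "Re (char_exponent \<nu> \<xi>) \<le> psi_star \<nu> r"
  unfolding psi_star_def
proof (rule cSUP_upper)
  show "bdd_above ((\<lambda>\<xi>. Re (char_exponent \<nu> \<xi>)) ` {\<xi>. norm \<xi> \<le> r})"
  proof (intro bdd_aboveI2)
    fix \<eta> :: 'a assume \<eta>: "\<eta> \<in> {\<xi>. norm \<xi> \<le> r}"
    have "Re (char_exponent \<nu> \<eta>) \<le> cmod (char_exponent \<nu> \<eta>)" by (rule complex_Re_le_cmod)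
    also have "\<dots> \<le> (LINT z|\<nu>. (2 + r) * cut_norm z)"
      unfolding char_exponent_def
    proof (rule Bochner_Integration.integral_norm_bound_integral)
      fix z
      have "cmod (1 - iexp (\<eta> \<bullet> z)) \<le> (2 + norm \<eta>) * cut_norm z"
        using norm_char_diff_le[of \<eta> z 0] by (simp add: norm_minus_commute)
      also have "\<dots> \<le> (2 + r) * cut_norm z" using \<eta> by (intro mult_right_mono) auto
      finally show "cmod (1 - iexp (\<eta> \<bullet> z)) \<le> (2 + r) * cut_norm z" .
    qed (use assms in \<open>auto intro: integrable_char_minus_one\<close>)
    finally show "Re (char_exponent \<nu> \<eta>) \<le> (LINT z|\<nu>. (2 + r) * cut_norm z)" .
  qed
qed (use assms in simp)

lemma psi_star_nonneg:
  fixes \<nu> :: "'a::euclidean_space measure"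
  assumes "sets \<nu> = sets borel" "integrable \<nu> cut_norm" "0 \<le> r"
  shows "0 \<le> psi_star \<nu> r"
  using Re_char_exponent_nonneg[OF assms(1,2), of 0]
    Re_char_exponent_le_psi_star[OF assms(1,2), of 0 r] assms(3)
  by (simp add: order.trans)

text \<open>The mean of $1 - \cos(sa)$ over $s \in [0,\rho]$ is $1 - \frac{\sin(\rho a)}{\rho a}$, and this is at
  least $\frac12$ for $|\rho a| \ge 2$. Averaging removes the zeros that $1 - \cos(sa)$ has for a fixed
  frequency.\<close>

lemma nn_integral_one_minus_cos:
  assumes "0 < \<rho>" "2 / \<rho> \<le> \<bar>a\<bar>"
  shows "ennreal (\<rho> / 2) \<le> (\<integral>\<^sup>+s. ennreal (1 - cos (s * a)) * indicator {0..\<rho>} s \<partial>lborel)"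
proof -
  have a: "a \<noteq> 0" using assms by auto
  have "(\<integral>\<^sup>+s. ennreal (1 - cos (s * a)) * indicator {0..\<rho>} s \<partial>lborel) =
      ennreal ((\<rho> - sin (\<rho> * a) / a) - (0 - sin (0 * a) / a))"
  proof (rule nn_integral_FTC_Icc)
    show "((\<lambda>s. s - sin (s * a) / a) has_real_derivative 1 - cos (s * a)) (at s)" for s
      using a by (auto intro!: derivative_eq_intros)
  qed (use assms in auto)
  moreover have "sin (\<rho> * a) / a \<le> \<rho> / 2"
  proof -
    have "sin (\<rho> * a) / a \<le> \<bar>sin (\<rho> * a)\<bar> / \<bar>a\<bar>"
      by (metis abs_divide abs_ge_self)
    also have "\<dots> \<le> 1 / \<bar>a\<bar>" using a by (intro divide_right_mono) auto
    also have "\<dots> \<le> \<rho> / 2" using assms a by (simp add: field_simps)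
    finally show ?thesis .
  qed
  ultimately show ?thesis by (simp add: ennreal_leI)
qed

text \<open>Integrate the preceding bound with respect to $\nu$ and exchange the integrals: what appears is the
  integral of $\mathrm{Re}\,\psi(s b)$ over $s \in [0,\rho]$.\<close>

lemma emeasure_tail_direction:
  fixes \<nu> :: "'a::euclidean_space measure"
  assumes sets [measurable_cong]: "sets \<nu> = sets borel" and zero: "emeasure \<nu> {0} = 0"
    and int: "integrable \<nu> cut_norm" and \<rho>: "0 < \<rho>" and b: "b \<in> Basis"
  shows "emeasure \<nu> {z. 2 / \<rho> \<le> \<bar>z \<bullet> b\<bar>} \<le> ennreal (2 * psi_star \<nu> \<rho>)"
proof -
  interpret sigma_finite_measure \<nu> by (rule sigma_finite_jump_measure[OF sets zero int])
  interpret P: pair_sigma_finite \<nu> "lborel :: real measure" ..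
  let ?T = "{z. 2 / \<rho> \<le> \<bar>z \<bullet> b\<bar>}"
  let ?f = "\<lambda>z s. ennreal (1 - cos (s * (z \<bullet> b))) * indicator {0..\<rho>} s"
  have T: "?T \<in> sets \<nu>" unfolding sets by measurable
  have psi: "0 \<le> psi_star \<nu> \<rho>"
    using \<rho> by (intro psi_star_nonneg[OF sets int]) simp
  have inner: "(\<integral>\<^sup>+z. ?f z s \<partial>\<nu>) \<le> ennreal (psi_star \<nu> \<rho>) * indicator {0..\<rho>} s" for s
  proof (cases "s \<in> {0..\<rho>}")
    case True
    have int_re: "integrable \<nu> (\<lambda>z. 1 - cos ((s *\<^sub>R b) \<bullet> z))"
      using integrable_Re[OF integrable_char_minus_one[OF sets int, of "s *\<^sub>R b"]]
      by (simp add: Re_exp)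
    have "(\<integral>\<^sup>+z. ?f z s \<partial>\<nu>) = (\<integral>\<^sup>+z. ennreal (1 - cos ((s *\<^sub>R b) \<bullet> z)) \<partial>\<nu>)"
      using True by (simp add: inner_commute)
    also have "\<dots> = ennreal (Re (char_exponent \<nu> (s *\<^sub>R b)))"
      unfolding Re_char_exponent[OF sets int] by (rule nn_integral_eq_integral[OF int_re]) auto
    also have "\<dots> \<le> ennreal (psi_star \<nu> \<rho>)"
      using True b by (intro ennreal_leI Re_char_exponent_le_psi_star[OF sets int]) auto
    finally show ?thesis using True by simp
  qed simp
  have "ennreal (\<rho> / 2) * emeasure \<nu> ?T = (\<integral>\<^sup>+z. ennreal (\<rho> / 2) * indicator ?T z \<partial>\<nu>)"
    using T by (simp add: nn_integral_cmult_indicator)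
  also have "\<dots> \<le> (\<integral>\<^sup>+z. (\<integral>\<^sup>+s. ?f z s \<partial>lborel) \<partial>\<nu>)"
    using nn_integral_one_minus_cos[OF \<rho>] by (intro nn_integral_mono) (auto split: split_indicator)
  also have "\<dots> = (\<integral>\<^sup>+s. (\<integral>\<^sup>+z. ?f z s \<partial>\<nu>) \<partial>lborel)"
    by (rule P.Fubini'[symmetric]) measurable
  also have "\<dots> \<le> (\<integral>\<^sup>+s. ennreal (psi_star \<nu> \<rho>) * indicator {0..\<rho>} s \<partial>lborel)"
    by (intro nn_integral_mono inner)
  also have "\<dots> = ennreal (psi_star \<nu> \<rho>) * ennreal \<rho>"
    using \<rho> by (simp add: nn_integral_cmult_indicator)
  finally have le: "ennreal (\<rho> / 2) * emeasure \<nu> ?T \<le> ennreal (psi_star \<nu> \<rho>) * ennreal \<rho>" .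
  have "emeasure \<nu> ?T = ennreal (2 / \<rho>) * (ennreal (\<rho> / 2) * emeasure \<nu> ?T)"
    using \<rho> by (simp flip: mult.assoc ennreal_mult)
  also have "\<dots> \<le> ennreal (2 / \<rho>) * (ennreal (psi_star \<nu> \<rho>) * ennreal \<rho>)"
    by (intro mult_left_mono le) auto
  also have "\<dots> = ennreal (2 / \<rho> * (psi_star \<nu> \<rho> * \<rho>))"
    using \<rho> psi by (simp add: ennreal_mult del: times_divide_eq_left)
  also have "2 / \<rho> * (psi_star \<nu> \<rho> * \<rho>) = 2 * psi_star \<nu> \<rho>"
    using \<rho> by simp
  finally show ?thesis .
qed

text \<open>A vector of norm at least $r$ has a coordinate of size at least $r/d$ in dimension $d$.\<close>

lemma emeasure_tail:
  fixes \<nu> :: "'a::euclidean_space measure"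
  assumes sets [measurable_cong]: "sets \<nu> = sets borel" and zero: "emeasure \<nu> {0} = 0"
    and int: "integrable \<nu> cut_norm" and r: "0 < r"
  shows "emeasure \<nu> {z. r \<le> norm z} \<le> ennreal (2 * real DIM('a) * psi_star \<nu> (DIM('a) / r * 2))"
proof -
  let ?\<rho> = "DIM('a) / r * 2"
  let ?T = "\<lambda>b::'a. {z. 2 / ?\<rho> \<le> \<bar>z \<bullet> b\<bar>}"
  have \<rho>: "0 < ?\<rho>" "2 / ?\<rho> = r / DIM('a)" using r by (auto simp: field_simps)
  have psi: "0 \<le> psi_star \<nu> ?\<rho>"
    using \<rho>(1) by (intro psi_star_nonneg[OF sets int]) simp
  have T: "?T b \<in> sets \<nu>" for b unfolding sets by measurable
  have "{z. r \<le> norm z} \<subseteq> (\<Union>b\<in>Basis. ?T b)"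
  proof (rule subsetI, rule ccontr)
    fix z assume z: "z \<in> {z. r \<le> norm z}" "z \<notin> (\<Union>b\<in>Basis. ?T b)"
    then have "\<bar>z \<bullet> b\<bar> < r / DIM('a)" if "b \<in> Basis" for b
      using that \<rho>(2) by auto
    then have "(\<Sum>b\<in>Basis. \<bar>z \<bullet> b\<bar>) < (\<Sum>b\<in>(Basis::'a set). r / DIM('a))"
      by (intro sum_strict_mono) auto
    with norm_le_l1[of z] z(1) show False by simp
  qed
  then have "emeasure \<nu> {z. r \<le> norm z} \<le> emeasure \<nu> (\<Union>b\<in>Basis. ?T b)"
    using T by (intro emeasure_mono) auto
  also have "\<dots> \<le> (\<Sum>b\<in>Basis. emeasure \<nu> (?T b))"
    using T by (intro emeasure_subadditive_finite) auto
  also have "\<dots> \<le> (\<Sum>b\<in>(Basis :: 'a set). ennreal (2 * psi_star \<nu> ?\<rho>))"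
    by (intro sum_mono emeasure_tail_direction[OF sets zero int \<rho>(1)])
  also have "\<dots> = ennreal (2 * real DIM('a) * psi_star \<nu> ?\<rho>)"
    using psi by (simp add: ennreal_mult' mult_ac flip: ennreal_of_nat_eq_real_of_nat)
  finally show ?thesis .
qed

text \<open>Dyadic summation of the tail bound. The layers $\{|z| \ge 2^{-k-1}\}$ receive the weights
  $2^{-k\beta} - 2^{-(k+1)\beta}$; with $\alpha = \beta/2$ the sum becomes a geometric series in
  $s = 2^{-\beta/2}$, whose large value $\frac{1}{1-s}$ is compensated by the factor $1 - s^2$ of the
  weights. Only the factor $\frac{1}{\alpha}$ of the tail bound survives.\<close>

lemma nn_integral_cut_norm_powr_le:
  fixes \<nu> :: "'a::euclidean_space measure"
  assumes sets [measurable_cong]: "sets \<nu> = sets borel" and D: "0 \<le> D"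
    and tail: "\<And>\<alpha> r. 0 < \<alpha> \<Longrightarrow> \<alpha> < 1 \<Longrightarrow> 0 < r \<Longrightarrow> r \<le> 1 \<Longrightarrow>
      emeasure \<nu> {z. r \<le> norm z} \<le> ennreal (D / \<alpha> * r powr - \<alpha>)"
    and \<beta>: "0 < \<beta>" "\<beta> \<le> 1"
  shows "(\<integral>\<^sup>+z. ennreal (cut_norm z powr \<beta>) \<partial>\<nu>) \<le> ennreal (6 * D / \<beta>)"
proof -
  define s :: real where "s = (1/2) powr (\<beta> / 2)"
  have s: "1/2 \<le> s" "s < 1"
  proof -
    have "(1/2 :: real) powr 1 \<le> s" unfolding s_def using \<beta> by (intro powr_mono') auto
    then show "1/2 \<le> s" by simp
    have "s < 1 powr (\<beta> / 2)" unfolding s_def using \<beta> by (intro powr_less_mono2) auto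
    then show "s < 1" by simp
  qed
  have pow: "((1/2) ^ k :: real) powr (\<beta> / 2) = s ^ k" for k
  proof -
    have "((1/2) ^ k :: real) powr (\<beta> / 2) = ((1/2) powr real k) powr (\<beta> / 2)"
      by (subst powr_realpow) simp_all
    also have "\<dots> = s powr real k"
      unfolding s_def powr_powr by (simp only: mult.commute)
    also have "\<dots> = s ^ k"
      using s by (intro powr_realpow) linarith
    finally show ?thesis .
  qed
  have powb: "((1/2) ^ k :: real) powr \<beta> = (s ^ 2) ^ k" for k
  proof -
    have "((1/2) ^ k :: real) powr \<beta> = ((1/2) ^ k) powr (\<beta> / 2) * ((1/2) ^ k) powr (\<beta> / 2)"
      by (simp flip: powr_add)
    then show ?thesis by (simp add: pow power2_eq_square power_mult_distrib)
  qed
  define c where "c k = (s ^ 2) ^ k * (1 - s ^ 2)" for k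
  have s2: "0 \<le> s ^ 2" "s ^ 2 < 1" using s by (auto simp: abs_square_less_1)
  have c: "0 \<le> c k" for k using s2 by (auto simp: c_def)
  let ?T = "\<lambda>k. {z :: 'a. (1/2) ^ Suc k \<le> norm z}"
  have T: "?T k \<in> sets \<nu>" for k unfolding sets by measurable
  have pointwise: "ennreal (cut_norm z powr \<beta>) \<le> (\<Sum>k. ennreal (c k) * indicator (?T k) z)" for z
  proof (cases "z = 0")
    case False
    have "\<exists>k. (1/2) ^ Suc k \<le> norm z"
    proof -
      obtain k where "(1/2) ^ k < norm z"
        using real_arch_pow_inv[of "norm z" "1/2"] False by auto
      moreover have "(1/2 :: real) ^ Suc k \<le> (1/2) ^ k" by simp
      ultimately show ?thesis by (intro exI[of _ k]) linarith
    qed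
    \<comment> \<open>the first dyadic layer that contains \<open>z\<close>\<close>
    define j where "j = (LEAST k. (1/2) ^ Suc k \<le> norm z)"
    have j: "(1/2) ^ Suc j \<le> norm z"
      unfolding j_def by (rule LeastI_ex) fact
    have "cut_norm z \<le> (1/2) ^ j"
    proof (cases j)
      case (Suc i)
      then have "\<not> (1/2) ^ Suc i \<le> norm z"
        using not_less_Least[of i "\<lambda>k. (1/2) ^ Suc k \<le> norm z"] by (simp add: j_def)
      with Suc show ?thesis by (simp add: cut_norm_def)
    qed simp
    then have "cut_norm z powr \<beta> \<le> (s ^ 2) ^ j"
      unfolding powb[symmetric] using \<beta> by (intro powr_mono2) auto
    then have "ennreal (cut_norm z powr \<beta>) \<le> ennreal ((s ^ 2) ^ j)" by (rule ennreal_leI)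
    also have "\<dots> = (\<Sum>k. ennreal (c (k + j)))"
    proof -
      have "(\<lambda>k. (s ^ 2) ^ j * (1 - s ^ 2) * (s ^ 2) ^ k) sums ((s ^ 2) ^ j * (1 - s ^ 2) * (1 / (1 - s ^ 2)))"
        using s2 by (intro sums_mult geometric_sums) auto
      then have "(\<lambda>k. c (k + j)) sums ((s ^ 2) ^ j)"
        using s2 by (simp add: c_def power_add mult_ac)
      then show ?thesis
        by (intro suminf_ennreal_eq[symmetric] c)
    qed
    also have "\<dots> \<le> (\<Sum>k. ennreal (c (k + j)) * indicator (?T (k + j)) z)"
    proof (intro suminf_le summableI)
      fix k
      have "(1/2 :: real) ^ Suc (k + j) \<le> (1/2) ^ Suc j" by (intro power_decreasing) auto
      then have "(1/2) ^ Suc (k + j) \<le> norm z" using j by (rule order_trans)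
      then have "z \<in> ?T (k + j)" by (simp only: mem_Collect_eq)
      then show "ennreal (c (k + j)) \<le> ennreal (c (k + j)) * indicator (?T (k + j)) z"
        by (simp only: indicator_simps mult_1_right order_refl)
    qed
    also have "\<dots> \<le> (\<Sum>k. ennreal (c k) * indicator (?T k) z)"
      by (subst (2) suminf_offset[of _ j]) (auto intro: summableI)
    finally show ?thesis .
  qed simp
  have "(\<integral>\<^sup>+z. ennreal (cut_norm z powr \<beta>) \<partial>\<nu>) \<le> (\<integral>\<^sup>+z. (\<Sum>k. ennreal (c k) * indicator (?T k) z) \<partial>\<nu>)"
    by (intro nn_integral_mono pointwise)
  also have "\<dots> = (\<Sum>k. ennreal (c k) * emeasure \<nu> (?T k))"
    using T by (subst nn_integral_suminf) (auto simp: nn_integral_cmult_indicator)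
  also have "\<dots> \<le> (\<Sum>k. ennreal (2 * D / \<beta> * ((1 - s ^ 2) / s) * s ^ k))"
  proof (intro suminf_le summableI)
    fix k
    have "emeasure \<nu> (?T k) \<le> ennreal (D / (\<beta> / 2) * ((1/2) ^ Suc k) powr - (\<beta> / 2))"
      using \<beta> power_le_one[of "1/2 :: real" "Suc k"] by (intro tail) auto
    then have "ennreal (c k) * emeasure \<nu> (?T k) \<le>
        ennreal (c k) * ennreal (D / (\<beta> / 2) * ((1/2) ^ Suc k) powr - (\<beta> / 2))"
      by (intro mult_left_mono) auto
    also have "\<dots> = ennreal (c k * (D / (\<beta> / 2) * ((1/2) ^ Suc k) powr - (\<beta> / 2)))"
      using c D \<beta> by (intro ennreal_mult[symmetric]) auto
    also have "c k * (D / (\<beta> / 2) * ((1/2) ^ Suc k) powr - (\<beta> / 2)) = 2 * D / \<beta> * ((1 - s ^ 2) / s) * s ^ k"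
      unfolding powr_minus pow c_def using s \<beta>
      by (simp add: field_simps power2_eq_square power_mult_distrib)
    finally show "ennreal (c k) * emeasure \<nu> (?T k) \<le> \<dots>" .
  qed
  also have "\<dots> = ennreal (2 * D / \<beta> * ((1 - s ^ 2) / s) * (1 / (1 - s)))"
  proof (rule suminf_ennreal_eq)
    show "0 \<le> 2 * D / \<beta> * ((1 - s ^ 2) / s) * s ^ k" for k
      using D \<beta> s s2 by auto
    show "(\<lambda>k. 2 * D / \<beta> * ((1 - s ^ 2) / s) * s ^ k) sums (2 * D / \<beta> * ((1 - s ^ 2) / s) * (1 / (1 - s)))"
      using s by (intro sums_mult geometric_sums) auto
  qed
  also have "\<dots> \<le> ennreal (6 * D / \<beta>)"
  proof (rule ennreal_leI)
    have "(1 - s ^ 2) / s * (1 / (1 - s)) = (1 + s) / s"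
      using s by (simp add: field_simps power2_eq_square)
    also have "\<dots> \<le> 3" using s by (simp add: field_simps)
    finally have "2 * D / \<beta> * ((1 - s ^ 2) / s * (1 / (1 - s))) \<le> 2 * D / \<beta> * 3"
      using D \<beta> by (intro mult_left_mono) auto
    then show "2 * D / \<beta> * ((1 - s ^ 2) / s) * (1 / (1 - s)) \<le> 6 * D / \<beta>"
      by (simp add: mult.assoc)
  qed
  finally show ?thesis .
qed

text \<open>With $\theta = 2$ and $\rho = d/r$ in dimension $d$ the growth condition becomes the tail bound
  $(D/\alpha)\,r^{-\alpha}$, and each exponent $\beta$ takes $\alpha = \beta/2$. This is where the linear
  blow-up $M/\beta$ of the moments, on which the convergence of the series depends, comes from.\<close>

lemma jump_measure_logarithmic_exponent:
  fixes \<nu> :: "'a::euclidean_space measure"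
  assumes sets [measurable_cong]: "sets \<nu> = sets borel" and zero: "emeasure \<nu> {0} = 0"
    and fin: "(\<integral>\<^sup>+ z. ennreal (min 1 (norm z)) \<partial>\<nu>) < \<infinity>" and C: "0 < C"
    and growth: "\<forall>\<alpha>\<in>{0<..<1}. \<forall>\<rho>\<ge>1. \<forall>\<theta>>1.
      psi_star \<nu> (\<rho> * \<theta>) \<le> C / \<alpha> * \<rho> powr \<alpha> * psi_star \<nu> \<theta>"
  shows "\<exists>M\<ge>0. \<forall>\<beta>. 0 < \<beta> \<longrightarrow> \<beta> \<le> 1 \<longrightarrow>
    integrable \<nu> (\<lambda>z. cut_norm z powr \<beta>) \<and> (LINT z|\<nu>. cut_norm z powr \<beta>) \<le> M / \<beta>"
proof -
  have int: "integrable \<nu> cut_norm"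
    by (rule integrableI_nonneg) (use fin in \<open>auto simp: cut_norm_def\<close>)
  let ?n = "real DIM('a)"
  have n: "1 \<le> ?n" using DIM_ge_Suc0[where 'a='a] by linarith
  define D where "D = 2 * ?n * (C * ?n * psi_star \<nu> 2)"
  have psi: "0 \<le> psi_star \<nu> 2"
    by (intro psi_star_nonneg[OF sets int]) simp
  then have D: "0 \<le> D" using C n by (simp add: D_def)
  have tail: "emeasure \<nu> {z. r \<le> norm z} \<le> ennreal (D / \<alpha> * r powr - \<alpha>)"
    if \<alpha>: "0 < \<alpha>" "\<alpha> < 1" and r: "0 < r" "r \<le> 1" for \<alpha> r
  proof -
    have "r \<le> ?n" using n r by linarith
    then have "1 \<le> ?n / r" using r by (simp add: le_divide_eq)
    then have "psi_star \<nu> (?n / r * 2) \<le> C / \<alpha> * (?n / r) powr \<alpha> * psi_star \<nu> 2"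
      by (intro growth[rule_format]) (use \<alpha> in auto)
    also have "(?n / r) powr \<alpha> = ?n powr \<alpha> * r powr - \<alpha>"
      using n r by (simp add: powr_divide powr_minus_divide)
    also have "C / \<alpha> * (?n powr \<alpha> * r powr - \<alpha>) * psi_star \<nu> 2 \<le> C / \<alpha> * (?n powr 1 * r powr - \<alpha>) * psi_star \<nu> 2"
      using C \<alpha> n psi by (intro mult_right_mono mult_left_mono powr_mono) auto
    finally have "2 * ?n * psi_star \<nu> (?n / r * 2) \<le>
        2 * ?n * (C / \<alpha> * (?n powr 1 * r powr - \<alpha>) * psi_star \<nu> 2)"
      using n by (intro mult_left_mono) auto
    also have "\<dots> = D / \<alpha> * r powr - \<alpha>"
      using n by (simp add: D_def mult_ac)
    finally show ?thesis
      using emeasure_tail[OF sets zero int r(1)] by (meson ennreal_leI order_trans)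
  qed
  show ?thesis
  proof (intro exI[of _ "6 * D"] conjI allI impI)
    fix \<beta> :: real assume \<beta>: "0 < \<beta>" "\<beta> \<le> 1"
    note le = nn_integral_cut_norm_powr_le[OF sets D tail \<beta>]
    show "integrable \<nu> (\<lambda>z. cut_norm z powr \<beta>)"
      by (rule integrableI_nonneg) (use le in \<open>auto simp: less_top[symmetric] top_unique\<close>)
    then have "ennreal (LINT z|\<nu>. cut_norm z powr \<beta>) \<le> ennreal (6 * D / \<beta>)"
      using le by (simp add: nn_integral_eq_integral)
    then show "(LINT z|\<nu>. cut_norm z powr \<beta>) \<le> 6 * D / \<beta>"
      using D \<beta> by (simp add: ennreal_le_iff)
  qed (use D in simp)
qed

section \<open>Convergence of the exponential series\<close>

theorem theorem2:
  fixes \<nu> :: "(real ^ 'n) measure"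
    and p :: "real \<Rightarrow> (real ^ 'n) measure"
    and P :: "real \<Rightarrow> ((real ^ 'n) \<Rightarrow>\<^sub>C real) \<Rightarrow> ((real ^ 'n) \<Rightarrow>\<^sub>C real)"
    and L :: "((real ^ 'n) \<Rightarrow>\<^sub>C real) \<Rightarrow> ((real ^ 'n) \<Rightarrow>\<^sub>C real)"
    and f :: "(real ^ 'n) \<Rightarrow>\<^sub>C real"
    and \<beta> :: real
  assumes "sets \<nu> = sets borel"
    and "emeasure \<nu> {0} = 0"
    and "(\<integral>\<^sup>+ z. ennreal (min 1 (norm z)) \<partial>\<nu>) < \<infinity>"
    and "convolution_semigroup p"
    and "\<And>t \<xi>. t \<ge> 0 \<Longrightarrow>
           (CLINT x|p t. iexp (\<xi> \<bullet> x)) = exp (- complex_of_real t * char_exponent \<nu> \<xi>)"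
    and "\<exists>C>0. \<forall>\<alpha>\<in>{0<..<1}. \<forall>\<rho>\<ge>1. \<forall>\<theta>>1.
           psi_star \<nu> (\<rho> * \<theta>) \<le> C / \<alpha> * \<rho> powr \<alpha> * psi_star \<nu> \<theta>"
    and "0 < \<beta>" "\<beta> \<le> 1"
    and "f \<in> holder_C0 \<beta>"
  defines "P \<equiv> \<lambda>t. transition_op (p t)"
    and "L \<equiv> generator P"
  shows "(\<forall>k. (L ^^ k) f \<in> generator_domain P) \<and>
         (\<exists>t0>0. \<forall>t\<in>{0<..<t0}. (\<lambda>k. (t ^ k / fact k) *\<^sub>R (L ^^ k) f) sums P t f)"
proof -
  obtain C where "0 < C" "\<forall>\<alpha>\<in>{0<..<1}. \<forall>\<rho>\<ge>1. \<forall>\<theta>>1.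
      psi_star \<nu> (\<rho> * \<theta>) \<le> C / \<alpha> * \<rho> powr \<alpha> * psi_star \<nu> \<theta>"
    using assms(6) by blast
  from jump_measure_logarithmic_exponent[OF assms(1-3) this]
  obtain M where M: "0 \<le> M"
    "\<And>\<epsilon>. 0 < \<epsilon> \<Longrightarrow> \<epsilon> \<le> 1 \<Longrightarrow> integrable \<nu> (\<lambda>z. cut_norm z powr \<epsilon>)"
    "\<And>\<epsilon>. 0 < \<epsilon> \<Longrightarrow> \<epsilon> \<le> 1 \<Longrightarrow> (LINT z|\<nu>. cut_norm z powr \<epsilon>) \<le> M / \<epsilon>"
    by blast
  interpret jump_semigroup \<nu> p
  proof (intro jump_semigroup.intro jump_measure.intro jump_semigroup_axioms.intro)
    note p = assms(4)[unfolded convolution_semigroup_def]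
    show "prob_space (p t)" "sets (p t) = sets borel" if "0 \<le> t" for t
      using p that by blast+
    show "p 0 = return borel 0" using p by blast
    show "((\<lambda>t. LINT x|p t. apply_bcontfun \<phi> x) \<longlongrightarrow> apply_bcontfun \<phi> 0) (at_right 0)"
      for \<phi> :: "(real ^ 'n) \<Rightarrow>\<^sub>C real"
      using p by blast
  qed (fact assms(1) M(2) assms(5))+
  have M': "moment \<epsilon> \<le> M / \<epsilon>" if "0 < \<epsilon>" "\<epsilon> \<le> 1" for \<epsilon>
    unfolding moment_def using that by (rule M(3))
  have f: "f \<in> C0" using assms(9) by (simp add: holder_C0_def)
  obtain K where K: "hoelder \<beta> K (apply_bcontfun f)"
    using holder_C0_hoelder[OF assms(9,7)] by blast
  have hv: "hoelder_vanishing f"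
    unfolding hoelder_vanishing_def using f K assms(7,8) by blast
  have iter: "(L ^^ k) f = (jump_bcontfun ^^ k) f" for k
    unfolding L_def P_def by (rule generator_iterate[OF hv])
  have "(\<lambda>k. (t ^ k / fact k) *\<^sub>R (L ^^ k) f) sums P t f"
    if "t \<in> {0<..<\<beta> / (4 * exp 1 * (M + 1))}" for t
  proof -
    have t: "0 < t" "t * (4 * exp 1 * (M + 1)) < \<beta>"
      using that M(1) by (auto simp: less_divide_eq)
    have "4 * exp 1 * M * t \<le> t * (4 * exp 1 * (M + 1))"
      using t(1) by (simp add: algebra_simps)
    also note t(2)
    finally have lt: "4 * exp 1 * M * t < \<beta>" .
    show ?thesis
      unfolding iter P_def
      by (rule exponential_series[OF f K assms(7,8) M(1) _ _ lt]) (use M' t(1) in auto)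
  qed
  moreover have "0 < \<beta> / (4 * exp 1 * (M + 1))"
    using assms(7) M(1) by (intro divide_pos_pos mult_pos_pos) auto
  moreover have "(L ^^ k) f \<in> generator_domain P" for k
    unfolding iter P_def by (rule generator_domain_hoelder[OF hoelder_vanishing_iterate[OF hv]])
  ultimately show ?thesis by blast
qed

end
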